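(* Let $L$ be a Lelek fan and let $Y$ be a non-degenerate continuum. The following are equivalent: 1. there is an embedding $e:Y\to L$ and a retraction $r:L\to e(Y)$ that is a confluent map; 2. there is a confluent surjective map $f:L\to Y$; 3. $Y$ is a Lelek fan.
   Context: A continuum is a nonempty compact connected metric space; it is non-degenerate if it has more than one point. A dendroid is an arcwise connected, hereditarily unicoherent continuum. A point $x$ of a dendroid $X$ is a ramification point if $x$ is the top (the branch point) of some simple triod in $X$. A fan is a dendroid with at most one ramification point; this point, if it exists, is called the top of the fan. For a fan $X$, a point $x$ is an end point of $X$ if $x$ is an end point of every arc in $X$ containing $x$; $E(X)$ denotes the set of end points of $X$. A fan $X$ with top $v$ is smooth if for every $x\in X$ and every sequence $x_n\to x$ in $X$, the arcs from $v$ to $x_n$ converge (in the Hausdorff metric) to the arc from $v$ to $x$. A Lelek fan is a smooth fan $X$ with $\mathrm{Cl}(E(X))=X$. A continuous map $f:X\to Z$ between continua is confluent if for every subcontinuum $Q$ of $f(X)$ and every component $K$ of $f^{-1}(Q)$, $f(K)=Q$. A retraction from $X$ onto a subspace $Y$ is a continuous map $r:X\to Y$ with $r(y)=y$ for all $y\in Y$. An embedding is a continuous map that is a homeomorphism onto its image. *)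

theory Defs
  imports "HOL-Analysis.Analysis"
begin

definition continuum :: "'a::metric_space set \<Rightarrow> bool" where
  "continuum X \<longleftrightarrow> X \<noteq> {} \<and> compact X \<and> connected X"

definition nondegenerate :: "'a set \<Rightarrow> bool" where
  "nondegenerate X \<longleftrightarrow> (\<exists>x\<in>X. \<exists>y\<in>X. x \<noteq> y)"

definition hausdorff_dist :: "'a::metric_space set \<Rightarrow> 'a set \<Rightarrow> real" where
  "hausdorff_dist A B = max (SUP a\<in>A. infdist a B) (SUP b\<in>B. infdist b A)"

definition arc_in :: "'a::metric_space set \<Rightarrow> 'a \<Rightarrow> 'a \<Rightarrow> 'a set \<Rightarrow> bool" where
  "arc_in X a b S \<longleftrightarrow> S \<subseteq> X \<and>
     ((a = b \<and> S = {a}) \<or>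
      (\<exists>g. arc g \<and> pathstart g = a \<and> pathfinish g = b \<and> path_image g = S))"

definition arcwise_connected :: "'a::metric_space set \<Rightarrow> bool" where
  "arcwise_connected X \<longleftrightarrow>
     (\<forall>x\<in>X. \<forall>y\<in>X. x \<noteq> y \<longrightarrow>
        (\<exists>g. arc g \<and> path_image g \<subseteq> X \<and> pathstart g = x \<and> pathfinish g = y))"

definition hereditarily_unicoherent :: "'a::metric_space set \<Rightarrow> bool" where
  "hereditarily_unicoherent X \<longleftrightarrow>
     (\<forall>P Q. P \<subseteq> X \<and> Q \<subseteq> X \<and> continuum P \<and> continuum Q \<longrightarrow> connected (P \<inter> Q))"

definition dendroid :: "'a::metric_space set \<Rightarrow> bool" where
  "dendroid X \<longleftrightarrow> continuum X \<and> arcwise_connected X \<and> hereditarily_unicoherent X"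

definition ramification_point :: "'a::metric_space set \<Rightarrow> 'a \<Rightarrow> bool" where
  "ramification_point X v \<longleftrightarrow>
     (\<exists>g1 g2 g3. arc g1 \<and> arc g2 \<and> arc g3 \<and>
        pathstart g1 = v \<and> pathstart g2 = v \<and> pathstart g3 = v \<and>
        path_image g1 \<subseteq> X \<and> path_image g2 \<subseteq> X \<and> path_image g3 \<subseteq> X \<and>
        path_image g1 \<inter> path_image g2 = {v} \<and>
        path_image g1 \<inter> path_image g3 = {v} \<and>
        path_image g2 \<inter> path_image g3 = {v})"

definition fan :: "'a::metric_space set \<Rightarrow> bool" where
  "fan X \<longleftrightarrow> dendroid X \<and>
     (\<forall>u v. ramification_point X u \<and> ramification_point X v \<longrightarrow> u = v)"

definition end_points :: "'a::metric_space set \<Rightarrow> 'a set" where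
  "end_points X = {x\<in>X. \<forall>g. arc g \<and> path_image g \<subseteq> X \<and> x \<in> path_image g \<longrightarrow>
                          x = pathstart g \<or> x = pathfinish g}"

definition smooth_fan :: "'a::metric_space set \<Rightarrow> bool" where
  "smooth_fan X \<longleftrightarrow> fan X \<and>
     (\<exists>v. ramification_point X v \<and>
        (\<forall>xs x As A. (\<forall>n. xs n \<in> X) \<and> x \<in> X \<and> xs \<longlonglongrightarrow> x \<and>
            (\<forall>n. arc_in X v (xs n) (As n)) \<and> arc_in X v x A \<longrightarrow>
            (\<lambda>n. hausdorff_dist (As n) A) \<longlonglongrightarrow> 0))"

definition lelek_fan :: "'a::metric_space set \<Rightarrow> bool" where
  "lelek_fan X \<longleftrightarrow> smooth_fan X \<and> closure (end_points X) = X"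

definition confluent :: "'a::metric_space set \<Rightarrow> ('a \<Rightarrow> 'b::metric_space) \<Rightarrow> bool" where
  "confluent X f \<longleftrightarrow> continuous_on X f \<and>
     (\<forall>Q K. Q \<subseteq> f ` X \<and> continuum Q \<and> K \<in> components (X \<inter> f -` Q) \<longrightarrow> f ` K = Q)"

definition embedding_on :: "'b::metric_space set \<Rightarrow> ('b \<Rightarrow> 'a::metric_space) \<Rightarrow> bool" where
  "embedding_on Y e \<longleftrightarrow> (\<exists>e'. homeomorphism Y (e ` Y) e e')"

end

theory Submission
  imports Defs
begin

text \<open>
  On a smooth fan with top \<open>v\<close> let \<open>x \<le> y\<close> iff \<open>x\<close> lies on the arc from \<open>v\<close> to \<open>y\<close>; smoothness
  makes this order closed. Lifting arcs through a confluent map \<open>f\<close> at a point \<open>x \<noteq> v\<close> leaves only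
  two directions, inwards and outwards. This forces the image to be a fan with top \<open>f v\<close>, sends
  end points to end points or to \<open>f v\<close>, makes the preimage of \<open>f v\<close> connected and \<open>f\<close> monotone for
  the two orders, so smoothness and density of the end points pass to the image.

  Conversely, any two Lelek fans are homeomorphic. A continuous strictly increasing length function
  and the clopen subsets of \<open>X - {v}\<close> (sectors) determine a smooth fan. Density of
  end points lets one split a sector so that the maximal lengths of the parts are prescribed up to a
  factor close to 1. Matching finer and finer partitions of the two fans into sectors in
  this way, the ratios of maximal lengths converge uniformly, and rescaling matched legs
  by the limit ratio is the homeomorphism.
\<close>

section \<open>Arcs in dendroids and the order of a fan\<close>

text \<open>Uniqueness makes the first condition cheap: a homeomorphism of \<open>Y\<close> onto
  \<open>L\<close> is an embedding, and the identity of \<open>L\<close> is then a confluent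
  retraction onto its image. For confluent images, arcs in the image must be known to be unique
  before directions at an image point can be compared; so hereditary unicoherence has to come from
  lifting continua rather than arcs. In the converse the obstacle is that dense end points only
  yield sectors of height near a wanted value, so the ratios of heights cannot all be preserved when
  a sector is cut. The part containing a highest point keeps its ratio and only the other part is
  perturbed. Logarithms of ratios are recorded and may change by at most (1/2)^n at level n, which
  turns the error along a branch into a geometric sum. Cuts prescribed on the two fans alternate, so
  that in the limit points of equal length are separated on both sides.\<close>

text \<open>In a dendroid, \<open>seg X a b\<close> is the arc from \<open>a\<close> to \<open>b\<close>.\<close>

definition seg :: "'a::metric_space set \<Rightarrow> 'a \<Rightarrow> 'a \<Rightarrow> 'a set" where
  "seg X a b = \<Inter>{K. K \<subseteq> X \<and> continuum K \<and> a \<in> K \<and> b \<in> K}"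

text \<open>Pulled back along the inverse of \<open>g\<close>, \<open>C\<close> becomes a connected
  subset of the line, hence an interval through \<open>s\<close> and \<open>t\<close>.\<close>

lemma connected_in_arc_contains:
  fixes g :: "real \<Rightarrow> 'a::metric_space"
  assumes "arc g" "connected C" "C \<subseteq> path_image g" "g s \<in> C" "g t \<in> C" "s \<in> {0..1}" "t \<in> {0..1}"
  shows "g ` closed_segment s t \<subseteq> C"
proof -
  obtain h where h: "homeomorphism {0..1} (path_image g) g h"
    using homeomorphism_arc assms by blast
  have "connected (h ` C)"
    using h assms by (meson connected_continuous_image continuous_on_subset homeomorphism_cont2)
  moreover have "s \<in> h ` C" "t \<in> h ` C"
    using h assms by (metis homeomorphism_apply1 imageI)+
  ultimately have "closed_segment s t \<subseteq> h ` C"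
    by (metis convex_contains_segment is_interval_connected_1 is_interval_convex_1)
  moreover have "g ` h ` C = C"
    using h assms by (force simp: homeomorphism_def image_iff subset_iff)
  ultimately show ?thesis by blast
qed

section \<open>Arcs of a dendroid as least subcontinua\<close>

locale dendroid_space =
  fixes X :: "'a::metric_space set"
  assumes dendroid: "dendroid X"
begin

abbreviation S where "S \<equiv> seg X"

lemma continuum_X: "continuum X" and compact_X: "compact X"
  using dendroid by (auto simp: dendroid_def continuum_def)

lemma connected_Int: "P \<subseteq> X \<Longrightarrow> Q \<subseteq> X \<Longrightarrow> continuum P \<Longrightarrow> continuum Q \<Longrightarrow> connected (P \<inter> Q)"
  using dendroid unfolding dendroid_def hereditarily_unicoherent_def by blast

lemma seg_least: "K \<subseteq> X \<Longrightarrow> continuum K \<Longrightarrow> a \<in> K \<Longrightarrow> b \<in> K \<Longrightarrow> S a b \<subseteq> K"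
  unfolding seg_def by blast

text \<open>Hereditary unicoherence makes arcs unique: any continuum \<open>K\<close> through both
  points meets the arc in a connected set, which contains everything between them. So the
  intersection defining \<open>S\<close> is the subarc itself.\<close>

lemma seg_on_arc:
  assumes g: "arc g" "path_image g \<subseteq> X" and st: "s \<in> {0..1}" "t \<in> {0..1}"
  shows "S (g s) (g t) = g ` closed_segment s t"
proof
  have cont: "continuous_on {0..1} g"
    using g(1) arc_def path_def by blast
  have sub: "closed_segment s t \<subseteq> {0..1}"
    using st by (simp add: closed_segment_subset)
  have "continuum (g ` closed_segment s t)"
    unfolding continuum_def
    by (metis compact_continuous_image compact_segment connected_continuous_image connected_segment
        cont continuous_on_subset empty_iff ends_in_segment(1) image_is_empty sub)
  moreover have "g ` closed_segment s t \<subseteq> X"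
    using sub g(2) by (auto simp: path_image_def)
  ultimately show "S (g s) (g t) \<subseteq> g ` closed_segment s t"
    by (intro seg_least) auto
  show "g ` closed_segment s t \<subseteq> S (g s) (g t)"
    unfolding seg_def
  proof (rule Inter_greatest)
    fix K assume "K \<in> {K. K \<subseteq> X \<and> continuum K \<and> g s \<in> K \<and> g t \<in> K}"
    then have K: "K \<subseteq> X" "continuum K" "g s \<in> K" "g t \<in> K" by auto
    have "continuum (path_image g)"
      using g(1) by (simp add: arc_imp_path compact_path_image connected_path_image continuum_def)
    then have "connected (K \<inter> path_image g)"
      using K g connected_Int by blast
    moreover have "g s \<in> K \<inter> path_image g" "g t \<in> K \<inter> path_image g"
      using K st by (auto simp: path_image_def)
    ultimately have "g ` closed_segment s t \<subseteq> K \<inter> path_image g"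
      using connected_in_arc_contains g(1) st by blast
    then show "g ` closed_segment s t \<subseteq> K" by blast
  qed
qed

lemma seg_arc: "arc g \<Longrightarrow> path_image g \<subseteq> X \<Longrightarrow> S (pathstart g) (pathfinish g) = path_image g"
  using seg_on_arc[of g 0 1] by (auto simp: pathstart_def pathfinish_def path_image_def closed_segment_eq_real_ivl)

lemma seg_arc_obtain:
  assumes "a \<in> X" "b \<in> X" "a \<noteq> b"
  obtains g where "arc g" "path_image g \<subseteq> X" "pathstart g = a" "pathfinish g = b" "S a b = path_image g"
  using dendroid assms seg_arc unfolding dendroid_def arcwise_connected_def by metis

lemma seg_refl [simp]: "a \<in> X \<Longrightarrow> S a a = {a}"
  by (intro equalityI seg_least) (auto simp: continuum_def seg_def)

lemma seg_ends [simp]: "a \<in> S a b" "b \<in> S a b"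
  by (auto simp: seg_def)

lemma seg_commute: "S a b = S b a"
  unfolding seg_def by (rule arg_cong[where f = Inter]) blast

lemma seg_continuum: "a \<in> X \<Longrightarrow> b \<in> X \<Longrightarrow> continuum (S a b)"
proof (cases "a = b")
  case False
  assume "a \<in> X" "b \<in> X"
  then show ?thesis
    using seg_arc_obtain[OF _ _ False]
    by (metis arc_imp_path compact_path_image connected_path_image continuum_def path_image_nonempty)
qed (auto simp: continuum_def)

lemma seg_subset: "a \<in> X \<Longrightarrow> b \<in> X \<Longrightarrow> S a b \<subseteq> X"
  by (simp add: continuum_X seg_least)

lemma arc_in_iff: assumes "a \<in> X" "b \<in> X" shows "arc_in X a b A \<longleftrightarrow> A = S a b"
proof (cases "a = b")
  case True
  then show ?thesis
    using assms unfolding arc_in_def by (metis arc_distinct_ends empty_subsetI insert_subset seg_refl)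
next
  case False
  then show ?thesis
    using assms seg_arc seg_subset seg_arc_obtain[OF assms False] unfolding arc_in_def by metis
qed

lemma seg_split:
  assumes "a \<in> X" "b \<in> X" "c \<in> S a b"
  shows "S a b = S a c \<union> S c b" "S a c \<inter> S c b = {c}"
proof -
  have "S a b = S a c \<union> S c b \<and> S a c \<inter> S c b = {c}"
  proof (cases "a = b")
    case False
    then obtain g where g: "arc g" "path_image g \<subseteq> X" "pathstart g = a" "pathfinish g = b" "S a b = path_image g"
      using seg_arc_obtain assms by metis
    then obtain t where t: "t \<in> {0..1}" "c = g t"
      using assms by (auto simp: path_image_def)
    have "S a c = g ` {0..t}"
      using seg_on_arc[OF g(1,2), of 0 t] g t by (simp add: pathstart_def closed_segment_eq_real_ivl)
    moreover have "S c b = g ` {t..1}"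
      using seg_on_arc[OF g(1,2), of t 1] g t by (simp add: pathfinish_def closed_segment_eq_real_ivl)
    moreover have "g ` {0..t} \<inter> g ` {t..1} = g ` ({0..t} \<inter> {t..1})"
      using g(1) t by (intro inj_on_image_Int[of _ "{0..1}", symmetric]) (auto simp: arc_def)
    moreover have "{0..t} \<inter> {t..1} = {t}" "{0..t} \<union> {t..1} = {0..1}" using t by auto
    ultimately show ?thesis
      using g(5) t by (simp add: path_image_def flip: image_Un)
  qed (use assms in auto)
  then show "S a b = S a c \<union> S c b" "S a c \<inter> S c b = {c}" by auto
qed

lemma seg_linear:
  assumes "a \<in> X" "b \<in> X" "c \<in> S a b" "d \<in> S a b"
  shows "c \<in> S a d \<or> d \<in> S a c"
proof (cases "a = b")
  case False
  then obtain g where g: "arc g" "path_image g \<subseteq> X" "pathstart g = a" "pathfinish g = b" "S a b = path_image g"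
    using seg_arc_obtain assms by metis
  then obtain t u where t: "t \<in> {0..1}" "c = g t" "u \<in> {0..1}" "d = g u"
    using assms by (auto simp: path_image_def)
  have "S a c = g ` {0..t}" "S a d = g ` {0..u}"
    using seg_on_arc[OF g(1,2), of 0 t] seg_on_arc[OF g(1,2), of 0 u] g t
    by (simp_all add: pathstart_def closed_segment_eq_real_ivl)
  then show ?thesis
    using t by (cases "t \<le> u") auto
qed (use assms in auto)

lemma seg_antisym:
  assumes "a \<in> X" "c \<in> X" "d \<in> X" "c \<in> S a d" "d \<in> S a c"
  shows "c = d"
  using seg_split[of a c d] assms by (metis Int_iff seg_ends(2) seg_commute singletonD)

text \<open>\<open>z\<close> is the branch point of the two arcs from \<open>a\<close>: the last
  point on the arc to \<open>b\<close> that still lies on the arc to \<open>c\<close>. Connectedness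
  of the intersection prevents the arcs from parting and meeting again.\<close>

lemma seg_inter_obtain:
  assumes "a \<in> X" "b \<in> X" "c \<in> X"
  obtains z where "z \<in> X" "S a b \<inter> S a c = S a z" "S z b \<inter> S z c = {z}"
proof -
  have "\<exists>z\<in>X. S a b \<inter> S a c = S a z"
  proof (cases "a = b")
    case False
    then obtain g where g: "arc g" "path_image g \<subseteq> X" "pathstart g = a" "pathfinish g = b" "S a b = path_image g"
      using seg_arc_obtain assms by metis
    define T where "T = {0..1} \<inter> g -` S a c"
    have cont: "continuous_on {0..1} g"
      using g(1) arc_def path_def by blast
    have "closed (S a c)"
      using seg_continuum assms by (simp add: compact_imp_closed continuum_def)
    then have "compact T"
      using continuous_closed_preimage[OF cont closed_atLeastAtMost]
      unfolding T_def compact_eq_bounded_closed by (simp add: bounded_Int)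
    moreover have "0 \<in> T"
      using g by (auto simp: T_def pathstart_def)
    ultimately obtain m where m: "m \<in> T" "\<And>t. t \<in> T \<Longrightarrow> t \<le> m"
      using compact_attains_sup by (metis empty_iff)
    have m01: "m \<in> {0..1}" using m T_def by auto
    have "connected (S a b \<inter> S a c)"
      using connected_Int seg_continuum seg_subset assms by simp
    then have "g ` closed_segment 0 m \<subseteq> S a b \<inter> S a c"
      by (rule connected_in_arc_contains[OF g(1)]) (use g m m01 in \<open>auto simp: T_def pathstart_def path_image_def\<close>)
    moreover have "S a b \<inter> S a c \<subseteq> g ` closed_segment 0 m"
      using m m01 g by (auto simp: T_def path_image_def closed_segment_eq_real_ivl)
    ultimately have "S a b \<inter> S a c = S a (g m)"
      using seg_on_arc[OF g(1,2), of 0 m] g m01 by (auto simp: pathstart_def)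
    moreover have "g m \<in> X" using g m01 by (auto simp: path_image_def)
    ultimately show ?thesis by blast
  qed (use assms in \<open>auto intro!: bexI[of _ a]\<close>)
  then obtain z where z: "z \<in> X" "S a b \<inter> S a c = S a z" by blast
  then have zz: "z \<in> S a b" "z \<in> S a c" by (metis IntD1 IntD2 seg_ends(2))+
  have "S z b \<inter> S z c \<subseteq> S a z"
    using z zz seg_split assms by blast
  then have "S z b \<inter> S z c \<subseteq> {z}"
    using seg_split(2)[OF assms(1,2) zz(1)] by blast
  then show thesis using that z by (simp add: subset_antisym)
qed

text \<open>Converse of \<open>seg_split\<close>. The arc from \<open>a\<close> to \<open>b\<close>
  lies in the union of the two arcs at \<open>m\<close>; if it avoided \<open>m\<close>, these would
  cut it into two disjoint closed pieces.\<close>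

lemma seg_via:
  assumes "a \<in> X" "b \<in> X" "m \<in> X" "S m a \<inter> S m b = {m}"
  shows "m \<in> S a b"
proof (rule ccontr)
  assume m: "m \<notin> S a b"
  have "continuum (S m a \<union> S m b)"
    using seg_continuum[of m a] seg_continuum[of m b] assms
    by (auto simp: continuum_def connected_Un)
  then have sub: "S a b \<subseteq> S m a \<union> S m b"
    using assms seg_subset by (intro seg_least) auto
  have cl: "closed (S m a)" "closed (S m b)" and con: "connected (S a b)"
    using seg_continuum assms by (auto simp: continuum_def compact_imp_closed)
  have "S m a \<inter> S m b \<inter> S a b = {}" using assms(4) m by auto
  then have "S m a \<inter> S a b = {} \<or> S m b \<inter> S a b = {}"
    using con cl sub unfolding connected_closed by blast
  then show False using seg_ends by blast
qed

lemma seg_triod_ramification: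
  assumes "m \<in> X" "a \<in> X" "b \<in> X" "c \<in> X" "a \<noteq> m" "b \<noteq> m" "c \<noteq> m"
    and "S m a \<inter> S m b = {m}" "S m a \<inter> S m c = {m}" "S m b \<inter> S m c = {m}"
  shows "ramification_point X m"
proof -
  obtain g1 g2 g3 where "arc g1" "path_image g1 \<subseteq> X" "pathstart g1 = m" "S m a = path_image g1"
    "arc g2" "path_image g2 \<subseteq> X" "pathstart g2 = m" "S m b = path_image g2"
    "arc g3" "path_image g3 \<subseteq> X" "pathstart g3 = m" "S m c = path_image g3"
    using assms(1-7) seg_arc_obtain by metis
  then show ?thesis
    using assms unfolding ramification_point_def by metis
qed

lemma ramification_point_triod:
  assumes "ramification_point X m"
  obtains a b c where "m \<in> X" "a \<in> X" "b \<in> X" "c \<in> X" "a \<noteq> m" "b \<noteq> m" "c \<noteq> m"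
    "S m a \<inter> S m b = {m}" "S m a \<inter> S m c = {m}" "S m b \<inter> S m c = {m}"
proof -
  obtain g1 g2 g3 where g: "arc g1" "arc g2" "arc g3"
    "pathstart g1 = m" "pathstart g2 = m" "pathstart g3 = m"
    "path_image g1 \<subseteq> X" "path_image g2 \<subseteq> X" "path_image g3 \<subseteq> X"
    "path_image g1 \<inter> path_image g2 = {m}"
    "path_image g1 \<inter> path_image g3 = {m}"
    "path_image g2 \<inter> path_image g3 = {m}"
    using assms unfolding ramification_point_def by blast
  show thesis
  proof (rule that[of "pathfinish g1" "pathfinish g2" "pathfinish g3"])
    show "pathfinish g1 \<noteq> m" "pathfinish g2 \<noteq> m" "pathfinish g3 \<noteq> m"
      using g arc_distinct_ends by metis+
  qed (use g seg_arc[of g1] seg_arc[of g2] seg_arc[of g3] in auto)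
qed

lemma end_points_iff:
  "x \<in> end_points X \<longleftrightarrow> x \<in> X \<and> (\<forall>a\<in>X. \<forall>b\<in>X. x \<in> S a b \<longrightarrow> x = a \<or> x = b)"
  (is "?l \<longleftrightarrow> ?r")
proof
  assume ?l
  then show ?r
  proof (intro conjI ballI impI)
    fix a b assume ab: "a \<in> X" "b \<in> X" "x \<in> S a b"
    show "x = a \<or> x = b"
    proof (cases "a = b")
      case False
      then obtain g where "arc g" "path_image g \<subseteq> X" "pathstart g = a" "pathfinish g = b" "S a b = path_image g"
        using seg_arc_obtain ab by metis
      then show ?thesis using \<open>?l\<close> ab(3) unfolding end_points_def by blast
    qed (use ab in auto)
  qed (auto simp: end_points_def)
next
  assume r: ?r
  have "x = pathstart g \<or> x = pathfinish g" if "arc g" "path_image g \<subseteq> X" "x \<in> path_image g" for g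
    using r seg_arc[OF that(1,2)] that by (metis pathfinish_in_path_image pathstart_in_path_image subsetD)
  then show ?l
    using r unfolding end_points_def by blast
qed

end

section \<open>The order of points along the legs of a fan\<close>

text \<open>That \<open>v\<close> ramifies is left to a later locale, since a confluent image is
  handled as a fan before \<open>f v\<close> is known to ramify.\<close>

locale fan_space = dendroid_space +
  fixes v :: 'a
  assumes v_in: "v \<in> X" and ram: "\<And>u. ramification_point X u \<Longrightarrow> u = v"
begin

definition le :: "'a \<Rightarrow> 'a \<Rightarrow> bool" where "le x y \<longleftrightarrow> x \<in> S v y"

lemma le_refl [simp]: "le x x" by (simp add: le_def)
lemma le_v [simp]: "le v x" by (simp add: le_def)
lemma le_v_iff: "le x v \<longleftrightarrow> x = v" using v_in by (simp add: le_def)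
lemma le_in: "le x y \<Longrightarrow> y \<in> X \<Longrightarrow> x \<in> X"
  unfolding le_def using v_in seg_subset by blast
lemma le_antisym: "le x y \<Longrightarrow> le y x \<Longrightarrow> y \<in> X \<Longrightarrow> x = y"
  by (metis le_def le_in seg_antisym v_in)
lemma le_subset: "le x y \<Longrightarrow> y \<in> X \<Longrightarrow> S v x \<subseteq> S v y"
  unfolding le_def using seg_split v_in by blast
lemma le_trans: "le x y \<Longrightarrow> le y z \<Longrightarrow> z \<in> X \<Longrightarrow> le x z"
  using le_subset le_def by blast
lemma le_linear: "le x z \<Longrightarrow> le y z \<Longrightarrow> z \<in> X \<Longrightarrow> le x y \<or> le y x"
  unfolding le_def using seg_linear v_in by blast

text \<open>At the branch point \<open>z\<close> of the two arcs from \<open>v\<close>, the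
  directions to \<open>v\<close>, \<open>x\<close> and \<open>y\<close> form a triod unless
  \<open>z\<close> is one of these points. The three exceptions are the three cases.\<close>

lemma fan_cases:
  assumes "x \<in> X" "y \<in> X"
  shows "le x y \<or> le y x \<or> S v x \<inter> S v y = {v}"
proof -
  obtain z where z: "z \<in> X" "S v x \<inter> S v y = S v z" "S z x \<inter> S z y = {z}"
    using seg_inter_obtain v_in assms by metis
  then have zz: "z \<in> S v x" "z \<in> S v y" by (metis IntD1 IntD2 seg_ends(2))+
  show ?thesis
  proof (cases "z = x \<or> z = y \<or> z = v")
    case True
    then show ?thesis using zz z v_in unfolding le_def by auto
  next
    case False
    have "S z v \<inter> S z x = {z}" "S z v \<inter> S z y = {z}"
      using seg_split(2) zz assms v_in seg_commute by metis+
    then have "ramification_point X z"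
      using seg_triod_ramification[of z v x y] False z assms v_in by auto
    then show ?thesis using ram False by blast
  qed
qed

lemma seg_cases:
  assumes "x \<in> X" "y \<in> X"
  obtains "le x y" | "le y x" | "v \<in> S x y"
  using fan_cases[OF assms] seg_via assms v_in by blast

lemma seg_between:
  assumes "le x y" "le y z" "z \<in> X"
  shows "y \<in> S x z"
proof -
  have yX: "y \<in> X" and xX: "x \<in> X" using assms le_in le_trans by blast+
  have "x \<in> S v z" using assms le_trans le_def by blast
  then have "S v z = S v x \<union> S x z" using seg_split assms v_in by blast
  moreover have "y \<in> S v z" using assms le_def by blast
  moreover have "y \<in> S v x \<Longrightarrow> y = x" using assms xX yX le_antisym le_def by blast
  ultimately show ?thesis using seg_ends by auto
qed

lemma le_seg:
  assumes "le p x" "x \<in> X" "q \<in> S p x"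
  shows "le p q" "le q x"
proof -
  have sp: "S v x = S v p \<union> S p x" "S v p \<inter> S p x = {p}"
    using seg_split assms v_in le_def by blast+
  then show qx: "le q x" using assms le_def by blast
  have "le p q \<or> le q p" using le_linear qx assms by blast
  moreover have "le q p \<Longrightarrow> q = p" using assms sp le_def by blast
  ultimately show "le p q" by auto
qed

text \<open>An arc from \<open>z\<close> through \<open>v\<close> first runs down the whole leg
  below \<open>z\<close>.\<close>

lemma seg_inward_contains:
  assumes "z \<in> X" "u \<in> X" "le x z" "v \<in> S z u"
  shows "x \<in> S z u"
  using seg_split(1)[OF assms(1,2,4)] assms(3) seg_commute unfolding le_def by blast

text \<open>Legs are well defined off the top: the arcs to two points above
  \<open>x \<noteq> v\<close> share more than \<open>v\<close>, which excludes the third case of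
  \<open>fan_cases\<close>.\<close>

lemma le_upper_comparable:
  assumes "le x y" "le x z" "x \<noteq> v" "y \<in> X" "z \<in> X"
  shows "le y z \<or> le z y"
  using fan_cases[OF assms(4,5)] assms le_def by blast

lemma not_between_imp_v:
  assumes "x \<in> X" "y \<in> X" "v \<notin> S x y"
  shows "le x y \<or> le y x"
  using seg_cases assms by metis

lemma end_point_maximal:
  assumes "x \<in> end_points X" "x \<noteq> v" "le x y" "y \<in> X"
  shows "x = y"
  using assms v_in unfolding end_points_iff le_def by blast

end

section \<open>Hausdorff distance, arcs and smoothness\<close>

text \<open>Compactness bounds the suprema in \<open>hausdorff_dist\<close>, so that they really
  dominate the distances they collect.\<close>

lemma infdist_le_hausdorff_dist:
  assumes "compact A" "compact B" "B \<noteq> {}"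
  shows "a \<in> A \<Longrightarrow> infdist a B \<le> hausdorff_dist A B"
    and "a \<in> A \<Longrightarrow> infdist a B \<le> hausdorff_dist B A"
proof -
  have "bdd_above ((\<lambda>a. infdist a B) ` A)"
    using assms(1) by (intro bounded_imp_bdd_above compact_imp_bounded compact_continuous_image continuous_on_infdist continuous_on_id)
  then show "a \<in> A \<Longrightarrow> infdist a B \<le> hausdorff_dist A B" "a \<in> A \<Longrightarrow> infdist a B \<le> hausdorff_dist B A"
    unfolding hausdorff_dist_def by (auto intro: max.coboundedI1 max.coboundedI2 cSUP_upper)
qed

lemma hausdorff_dist_nonneg:
  assumes "compact A" "compact B" "A \<noteq> {}" "B \<noteq> {}"
  shows "0 \<le> hausdorff_dist A B"
  using assms infdist_le_hausdorff_dist(1)[OF assms(1,2,4)] by (metis ex_in_conv infdist_nonneg order_trans)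

lemma hausdorff_dist_le:
  assumes "A \<noteq> {}" "B \<noteq> {}" "\<And>a. a \<in> A \<Longrightarrow> infdist a B \<le> e" "\<And>b. b \<in> B \<Longrightarrow> infdist b A \<le> e"
  shows "hausdorff_dist A B \<le> e"
  unfolding hausdorff_dist_def using assms by (auto intro!: cSUP_least)

lemma infdist_less_obtain:
  assumes "infdist a B < d" "B \<noteq> {}"
  obtains b where "b \<in> B" "dist a b < d"
proof -
  have "\<exists>b\<in>B. dist a b < d"
  proof (rule ccontr)
    assume "\<not> ?thesis"
    then have "d \<le> infdist a B"
      using assms(2) unfolding infdist_notempty[OF assms(2)] by (intro cINF_greatest) auto
    then show False using assms(1) by simp
  qed
  then show thesis using that by blast
qed

lemma infdist_compact_attained:
  assumes "compact B" "B \<noteq> {}"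
  obtains b where "b \<in> B" "infdist a B = dist a b"
proof -
  obtain b where b: "b \<in> B" "\<And>c. c \<in> B \<Longrightarrow> dist a b \<le> dist a c"
    using continuous_attains_inf[OF assms continuous_on_dist[OF continuous_on_const continuous_on_id]] by blast
  then have "dist a b \<le> infdist a B"
    unfolding infdist_notempty[OF assms(2)] using assms(2) by (intro cINF_greatest) auto
  then show thesis using that b infdist_le by (metis antisym)
qed

lemma infdist_diff_le_hausdorff_dist:
  assumes "compact A" "compact B" "A \<noteq> {}" "B \<noteq> {}"
  shows "\<bar>infdist q A - infdist q B\<bar> \<le> hausdorff_dist A B"
proof -
  have *: "infdist q A \<le> infdist q B + infdist b A" if "b \<in> B" "infdist q B = dist q b" for b
    using infdist_triangle[of q A b] that by (simp add: add.commute)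
  have **: "infdist q B \<le> infdist q A + infdist a B" if "a \<in> A" "infdist q A = dist q a" for a
    using infdist_triangle[of q B a] that by (simp add: add.commute)
  obtain a b where "a \<in> A" "infdist q A = dist q a" "b \<in> B" "infdist q B = dist q b"
    using infdist_compact_attained[of A q] infdist_compact_attained[of B q] assms by metis
  then show ?thesis
    using *[of b] **[of a] infdist_le_hausdorff_dist(1)[OF assms(1,2,4), of a]
      infdist_le_hausdorff_dist(2)[OF assms(2,1,3), of b] by linarith
qed

lemma hausdorff_dist_image_tendsto:
  assumes f: "continuous_on X f" "compact X"
    and A: "\<And>n::nat. A n \<subseteq> X \<and> compact (A n) \<and> A n \<noteq> {}" and B: "B \<subseteq> X" "compact B" "B \<noteq> {}"
    and lim: "(\<lambda>n. hausdorff_dist (A n) B) \<longlonglongrightarrow> 0"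
  shows "(\<lambda>n. hausdorff_dist (f ` A n) (f ` B)) \<longlonglongrightarrow> 0"
proof (rule tendstoI)
  fix e :: real assume "e > 0"
  then obtain d where d: "d > 0" "\<And>x y. x \<in> X \<Longrightarrow> y \<in> X \<Longrightarrow> dist y x < d \<Longrightarrow> dist (f y) (f x) < e/2"
    using compact_uniformly_continuous[OF f] unfolding uniformly_continuous_on_def
    by (metis half_gt_zero)
  have half: "infdist (f a) (f ` C) \<le> e/2" if "a \<in> X" "C \<subseteq> X" "C \<noteq> {}" "infdist a C < d" for a C
  proof -
    obtain b where "b \<in> C" "dist a b < d" using infdist_less_obtain[OF \<open>infdist a C < d\<close> \<open>C \<noteq> {}\<close>] by blast
    then have "dist (f a) (f b) < e/2" using d that by blast
    then show ?thesis using \<open>b \<in> C\<close> infdist_le[of "f b" "f ` C" "f a"] by auto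
  qed
  have "\<forall>\<^sub>F n in sequentially. hausdorff_dist (A n) B < d"
    using order_tendstoD(2)[OF lim \<open>d > 0\<close>] .
  then show "\<forall>\<^sub>F n in sequentially. dist (hausdorff_dist (f ` A n) (f ` B)) 0 < e"
  proof eventually_elim
    case (elim n)
    have "hausdorff_dist (f ` A n) (f ` B) \<le> e/2"
    proof (rule hausdorff_dist_le)
      fix y assume "y \<in> f ` A n"
      then obtain a where "a \<in> A n" "y = f a" by blast
      then show "infdist y (f ` B) \<le> e/2"
        using half[of a B] infdist_le_hausdorff_dist(1)[of "A n" B a] A B elim by force
    next
      fix y assume "y \<in> f ` B"
      then obtain a where "a \<in> B" "y = f a" by blast
      then show "infdist y (f ` A n) \<le> e/2"
        using half[of a "A n"] infdist_le_hausdorff_dist(2)[of B "A n" a] A[of n] B elim by force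
    qed (use A B in auto)
    moreover have "compact (f ` A n)" "compact (f ` B)"
      using A B f by (meson compact_continuous_image continuous_on_subset)+
    then have "0 \<le> hausdorff_dist (f ` A n) (f ` B)"
      using A B by (intro hausdorff_dist_nonneg) auto
    ultimately show ?case using \<open>e > 0\<close> by (simp add: dist_real_def)
  qed
qed

text \<open>The library proves that paths contain arcs only in complete normed spaces; the Kuratowski
  embedding carries this over to metric spaces.\<close>

lemma kuratowski_embedding:
  obtains \<kappa> :: "'a::metric_space \<Rightarrow> 'a \<Rightarrow>\<^sub>C real" where "\<And>x y. dist (\<kappa> x) (\<kappa> y) = dist x y"
proof -
  fix a :: 'a
  have dd: "\<bar>dist x z - dist y z\<bar> \<le> dist x y" for x y z :: 'a
    by (metis abs_dist_diff_le dist_commute)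
  \<comment> \<open>Distances alone may be unbounded; subtracting those from a base point
    \<open>a\<close> gives bounded functions and leaves differences unchanged.\<close>
  define \<kappa> where "\<kappa> x = Bcontfun (\<lambda>z. dist x z - dist a z)" for x
  have "(\<lambda>z. dist x z - dist a z) \<in> bcontfun" for x
    by (rule bcontfun_normI[where b = "dist x a"])
      (auto intro!: continuous_intros simp: dd)
  then have app: "apply_bcontfun (\<kappa> x) z = dist x z - dist a z" for x z
    unfolding \<kappa>_def by (simp add: Bcontfun_inverse)
  have "dist (\<kappa> x) (\<kappa> y) = dist x y" for x y
  proof (rule antisym)
    show "dist (\<kappa> x) (\<kappa> y) \<le> dist x y"
      by (intro dist_bound) (simp add: app dist_real_def dd)
    show "dist x y \<le> dist (\<kappa> x) (\<kappa> y)"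
      using dist_bounded[of "\<kappa> x" y "\<kappa> y"] by (simp add: app dist_real_def)
  qed
  then show thesis using that by blast
qed

lemma metric_path_contains_arc:
  fixes p :: "real \<Rightarrow> 'a::metric_space"
  assumes "path p" and ab: "pathstart p \<noteq> pathfinish p"
  obtains q where "arc q" "path_image q \<subseteq> path_image p"
    "pathstart q = pathstart p" "pathfinish q = pathfinish p"
proof -
  obtain \<kappa> :: "'a \<Rightarrow> 'a \<Rightarrow>\<^sub>C real" where \<kappa>: "\<And>x y. dist (\<kappa> x) (\<kappa> y) = dist x y"
    using kuratowski_embedding by blast
  have inj: "inj \<kappa>" by (metis \<kappa> dist_eq_0_iff injI)
  have cont: "continuous_on A \<kappa>" for A
    unfolding continuous_on_iff using \<kappa> by metis
  have P: "path (\<kappa> \<circ> p)" using assms cont path_continuous_image by blast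
  have im: "path_image (\<kappa> \<circ> p) = \<kappa> ` path_image p" by (simp add: path_image_compose)
  obtain h where h: "homeomorphism (path_image p) (\<kappa> ` path_image p) \<kappa> h"
    using homeomorphism_compact[OF compact_path_image[OF assms(1)] cont refl] inj inj_on_subset by blast
  obtain q where q: "arc q" "path_image q \<subseteq> path_image (\<kappa> \<circ> p)"
    "pathstart q = \<kappa> (pathstart p)" "pathfinish q = \<kappa> (pathfinish p)"
  proof (rule path_contains_arc[OF P])
    show "\<kappa> (pathstart p) \<noteq> \<kappa> (pathfinish p)" using ab inj by (simp add: inj_eq)
  qed (auto simp: pathstart_compose pathfinish_compose)
  have "arc (h \<circ> q)"
    unfolding arc_def
  proof
    show "path (h \<circ> q)"
      using q h im by (metis arc_imp_path continuous_on_subset homeomorphism_cont2 path_continuous_image)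
    have "inj_on h (\<kappa> ` path_image p)"
      using homeomorphism_apply2[OF h] by (rule inj_on_inverseI)
    then have "inj_on h (path_image q)"
      using q(2) im by (metis inj_on_subset)
    then show "inj_on (h \<circ> q) {0..1}"
      using q(1) unfolding arc_def path_image_def by (simp add: comp_inj_on)
  qed
  moreover have "path_image (h \<circ> q) \<subseteq> path_image p"
    using h q im by (metis homeomorphism_image2 image_mono path_image_compose)
  moreover have "pathstart (h \<circ> q) = pathstart p" "pathfinish (h \<circ> q) = pathfinish p"
    using h q by (metis homeomorphism_apply1 pathfinish_in_path_image pathstart_in_path_image
        pathfinish_compose pathstart_compose)+
  ultimately show thesis using that by blast
qed

section \<open>The closed order of a smooth fan\<close>

locale smooth_fan_space = fan_space +
  assumes ram_v: "ramification_point X v"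
    and smooth: "\<And>xs x. (\<And>n. xs n \<in> X) \<Longrightarrow> x \<in> X \<Longrightarrow> xs \<longlonglongrightarrow> x \<Longrightarrow>
      (\<lambda>n. hausdorff_dist (S v (xs n)) (S v x)) \<longlonglongrightarrow> 0"
begin

text \<open>\<open>xs n\<close> lies on the arc to \<open>ys n\<close>, so its distance to the arc
  from \<open>v\<close> to \<open>y\<close> is at most a Hausdorff distance that tends to 0. Since
  that arc is closed, the limit lies on it.\<close>

lemma le_closed:
  assumes "\<And>n. ys n \<in> X" "\<And>n. le (xs n) (ys n)" "xs \<longlonglongrightarrow> x" "ys \<longlonglongrightarrow> y"
  shows "le x y"
proof -
  have yX: "y \<in> X" using assms compact_X closed_sequentially compact_imp_closed by blast
  have comp: "compact (S v z) \<and> S v z \<noteq> {}" if "z \<in> X" for z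
    using seg_continuum that v_in continuum_def by blast
  have "infdist (xs n) (S v y) \<le> hausdorff_dist (S v (ys n)) (S v y)" for n
    using infdist_le_hausdorff_dist(1)[of "S v (ys n)" "S v y" "xs n"] comp assms(1,2) yX
    unfolding le_def by simp
  then have "(\<lambda>n. infdist (xs n) (S v y)) \<longlonglongrightarrow> 0"
    by (intro Lim_null_comparison[OF _ smooth[OF assms(1) yX assms(4)]] always_eventually) (simp add: infdist_nonneg)
  moreover have "(\<lambda>n. infdist (xs n) (S v y)) \<longlonglongrightarrow> infdist x (S v y)"
    using assms(3) by (intro tendsto_intros)
  ultimately have "infdist x (S v y) = 0" using LIMSEQ_unique by blast
  then show ?thesis
    unfolding le_def using comp[OF yX] by (simp add: in_closed_iff_infdist_zero compact_imp_closed)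
qed

lemma v_not_end_point: "v \<notin> end_points X"
  using ramification_point_triod[OF ram_v] seg_via end_points_iff by metis

lemma end_point_max: "x \<in> end_points X \<Longrightarrow> le x y \<Longrightarrow> y \<in> X \<Longrightarrow> x = y"
  using end_point_maximal v_not_end_point by metis

end

lemma smooth_fan_spaceI:
  assumes "smooth_fan X"
  obtains v where "smooth_fan_space X v"
proof -
  obtain v where v: "ramification_point X v" and
    sm: "\<And>xs x As A. (\<forall>n. xs n \<in> X) \<and> x \<in> X \<and> xs \<longlonglongrightarrow> x \<and>
            (\<forall>n. arc_in X v (xs n) (As n)) \<and> arc_in X v x A \<longrightarrow>
            (\<lambda>n. hausdorff_dist (As n) A) \<longlonglongrightarrow> 0" and f: "fan X"
    using assms unfolding smooth_fan_def by metis
  interpret dendroid_space X using f by unfold_locales (simp add: fan_def)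
  have vX: "v \<in> X" using ramification_point_triod[OF v] by metis
  have "smooth_fan_space X v"
  proof unfold_locales
    show "u = v" if "ramification_point X u" for u using f v that unfolding fan_def by blast
    show "(\<lambda>n. hausdorff_dist (seg X v (xs n)) (seg X v x)) \<longlonglongrightarrow> 0"
      if "\<And>n. xs n \<in> X" "x \<in> X" "xs \<longlonglongrightarrow> x" for xs x
      using sm[of xs x "\<lambda>n. seg X v (xs n)" "seg X v x"] arc_in_iff vX that by blast
  qed (use v vX in auto)
  then show thesis using that by blast
qed

section \<open>Confluent images of smooth fans\<close>

locale confluent_fan_map = smooth_fan_space X v for X :: "'a::metric_space set" and v +
  fixes f :: "'a \<Rightarrow> 'b::metric_space" and Y :: "'b set"
  assumes conf: "confluent X f" and onto: "f ` X = Y" and continuum_Y: "continuum Y"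
begin

lemma cont_f: "continuous_on X f"
  using conf confluent_def by blast

lemma in_Y: "x \<in> X \<Longrightarrow> f x \<in> Y" using onto by blast

text \<open>The witness is the component through \<open>x\<close> of the preimage of
  \<open>Q\<close>: confluence makes it map onto \<open>Q\<close>, and it is closed in a compact
  set.\<close>

lemma lift_continuum:
  assumes "x \<in> X" "f x \<in> Q" "Q \<subseteq> Y" "continuum Q"
  obtains K where "K \<subseteq> X" "continuum K" "x \<in> K" "f ` K = Q"
proof -
  define K where "K = connected_component_set (X \<inter> f -` Q) x"
  have Kc: "K \<in> components (X \<inter> f -` Q)"
    unfolding K_def components_def using assms by blast
  have im: "f ` K = Q"
    using conf assms Kc onto unfolding confluent_def by blast
  have sub: "K \<subseteq> X \<inter> f -` Q" using Kc in_components_subset by blast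
  have "closed Q" using assms(4) by (simp add: continuum_def compact_imp_closed)
  then have "closed (X \<inter> f -` Q)"
    using cont_f compact_X by (simp add: compact_imp_closed continuous_closed_preimage)
  then have "closed K" using Kc closed_components by blast
  then have "compact K"
    using compact_Int_closed[OF compact_X] sub by (metis inf.absorb_iff2 le_inf_iff)
  then have "continuum K"
    using Kc in_components_connected in_components_nonempty continuum_def by blast
  then show thesis using that sub im assms unfolding K_def by auto
qed

lemma lift_seg:
  assumes "x \<in> X" "f x \<in> Q" "Q \<subseteq> Y" "continuum Q" "q \<in> Q"
  obtains u where "u \<in> X" "f u = q" "f ` S x u \<subseteq> Q"
proof -
  obtain K where K: "K \<subseteq> X" "continuum K" "x \<in> K" "f ` K = Q"
    using lift_continuum assms by blast
  then obtain u where "u \<in> K" "f u = q" using assms by blast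
  then show thesis using that K seg_least[of K x u] by blast
qed

section \<open>Outward marches and hereditary unicoherence of the image\<close>

text \<open>\<open>M\<close> and \<open>N\<close> stand for the two pieces of a disconnected
  intersection of continua \<open>P\<close> and \<open>Q\<close>; a march in \<open>P\<close> from
  \<open>M\<close> to \<open>N\<close> can then be prolonged by one in \<open>Q\<close> from
  \<open>N\<close> to \<open>M\<close>.\<close>

definition march :: "'b set \<Rightarrow> 'b set \<Rightarrow> 'b set \<Rightarrow> 'a \<Rightarrow> 'a \<Rightarrow> bool" where
  "march M N P x z \<longleftrightarrow> z \<in> X \<and> le x z \<and> f x \<in> M \<and> f z \<in> N \<and> f ` S x z \<subseteq> P"

text \<open>The overlap of \<open>S x z\<close> with the lifted arc \<open>S z u\<close> is
  connected, contains \<open>z\<close> and maps into \<open>P \<inter> Q\<close>, so its image stays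
  in \<open>N\<close>. Hence neither arc reaches the far end of the other, and \<open>u\<close> lies
  neither inwards of \<open>z\<close> nor beyond \<open>v\<close>.\<close>

lemma march_step:
  assumes PQ: "P \<subseteq> Y" "Q \<subseteq> Y" "continuum Q" "P \<inter> Q = M \<union> N"
    and MN: "closed M" "closed N" "M \<inter> N = {}" "M \<noteq> {}" and m: "march M N P x z"
  obtains u where "march N M Q z u"
proof -
  have z: "z \<in> X" "le x z" "f x \<in> M" "f z \<in> N" "f ` S x z \<subseteq> P" and x: "x \<in> X"
    using m le_in unfolding march_def by auto
  obtain q where q: "q \<in> M" "q \<in> Q" "f z \<in> Q" using MN PQ z by blast
  then obtain u where u: "u \<in> X" "f u = q" "f ` S z u \<subseteq> Q"
    using lift_seg[OF z(1) _ PQ(2,3)] by blast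
  have "connected (S x z \<inter> S z u)"
    using connected_Int seg_continuum seg_subset x z(1) u(1) by simp
  moreover have "S x z \<inter> S z u \<subseteq> X" using seg_subset x z by blast
  ultimately have "connected (f ` (S x z \<inter> S z u))"
    using cont_f connected_continuous_image continuous_on_subset by blast
  moreover have sub: "f ` (S x z \<inter> S z u) \<subseteq> M \<union> N" using z u PQ by blast
  moreover have "N \<inter> f ` (S x z \<inter> S z u) \<noteq> {}" using z by auto
  ultimately have disj: "M \<inter> f ` (S x z \<inter> S z u) = {}"
    using MN unfolding connected_closed by blast
  have 1: "x \<notin> S z u" "u \<notin> S x z"
    using disj z q u by auto
  have "le z u"
    using z(1) u(1)
  proof (cases rule: seg_cases)
    case 2
    then have "le x u \<or> le u x" using le_linear z by blast
    then show ?thesis using seg_between z 2 1 seg_commute by metis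
  next
    case 3
    then show ?thesis using seg_inward_contains z u 1 by blast
  qed
  then have "march N M Q z u" unfolding march_def using u q z by auto
  then show thesis using that by blast
qed

text \<open>Marching outwards along a leg through components of the preimages of two continua yields a
  monotone sequence whose images alternate between two disjoint closed sets.\<close>

lemma no_march:
  assumes PQ: "P \<subseteq> Y" "Q \<subseteq> Y" "continuum P" "continuum Q" "P \<inter> Q = M \<union> N"
    and MN: "closed M" "closed N" "M \<inter> N = {}" "M \<noteq> {}" "N \<noteq> {}"
  shows "\<not> march M N P x z"
proof
  assume m: "march M N P x z"
  have "\<exists>p'. march M N P (fst p') (snd p') \<and> le (snd p) (fst p')"
    if mp: "march M N P (fst p) (snd p)" for p
  proof -
    obtain u where u: "march N M Q (snd p) u" using march_step[OF PQ(1,2,4,5) MN(1-4) mp] .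
    obtain u' where u': "march M N P u u'"
      using march_step[OF PQ(2,1,3) _ MN(2,1) _ MN(5) u] PQ(5) MN(3) by (metis inf_commute sup_commute)
    show ?thesis using u u' unfolding march_def by (intro exI[of _ "(u, u')"]) simp
  qed
  then obtain p where p: "\<And>n::nat. march M N P (fst (p n)) (snd (p n)) \<and> le (snd (p n)) (fst (p (Suc n)))"
    using dependent_nat_choice[of "\<lambda>n p. march M N P (fst p) (snd p)" "\<lambda>n p p'. le (snd p) (fst p')"] m
    by (metis fst_conv snd_conv)
  define a b where "a n = fst (p n)" and "b n = snd (p n)" for n
  have ab: "b n \<in> X" "a n \<in> X" "le (a n) (b n)" "le (b n) (a (Suc n))" "f (a n) \<in> M" "f (b n) \<in> N" for n
    using p[of n] le_in unfolding a_def b_def march_def by auto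
  have mono: "le (a n) (a m)" if "n \<le> m" for n m
    using that
  proof (induction m rule: dec_induct)
    case (step k)
    then show ?case using ab le_trans by meson
  qed simp
  have ba: "le (b n) (a m)" if "n < m" for n m
    using mono[of "Suc n" m] that ab le_trans by (meson Suc_leI)
  obtain A r where A: "A \<in> X" "strict_mono r" "(a \<circ> r) \<longlonglongrightarrow> A"
    using compact_X ab(2) unfolding compact_def by meson
  obtain B s where B: "B \<in> X" "strict_mono s" "(b \<circ> r \<circ> s) \<longlonglongrightarrow> B"
    using compact_X ab(1) unfolding compact_def by (metis comp_apply)
  have A': "(a \<circ> r \<circ> s) \<longlonglongrightarrow> A" using A B LIMSEQ_subseq_LIMSEQ by blast
  \<comment> \<open>Shifting the subsequence index by \<open>n\<close> reaches terms of index at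
    least \<open>n\<close>. Below, the shift for \<open>b\<close> is by \<open>Suc n\<close>,
    because \<open>le (b n) (a m)\<close> asks for a strictly larger index.\<close>
  have rs: "n \<le> r (s n)" for n
    using seq_suble[OF B(2), of n] seq_suble[OF A(2), of "s n"] by linarith
  have bA: "le (b n) A" for n
  proof (rule le_closed[of "\<lambda>k. a (r (s (k + Suc n)))" "\<lambda>k. b n"])
    show "le (b n) (a (r (s (k + Suc n))))" for k
      using ba rs[of "k + Suc n"] by simp
    show "(\<lambda>k. a (r (s (k + Suc n)))) \<longlonglongrightarrow> A"
      using LIMSEQ_ignore_initial_segment[OF A', of "Suc n"] by (simp add: comp_def)
  qed (use ab in auto)
  have aB: "le (a n) B" for n
  proof (rule le_closed[of "\<lambda>k. b (r (s (k + n)))" "\<lambda>k. a n"])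
    show "le (a n) (b (r (s (k + n))))" for k
      using mono[of n "r (s (k + n))"] rs[of "k + n"] ab le_trans by (meson add_leD2)
    show "(\<lambda>k. b (r (s (k + n)))) \<longlonglongrightarrow> B"
      using LIMSEQ_ignore_initial_segment[OF B(3), of n] by (simp add: comp_def)
  qed (use ab in auto)
  \<comment> \<open>The terms interlace, so each limit dominates the other. Antisymmetry merges
    them, although \<open>f\<close> sends one into \<open>M\<close> and the other into
    \<open>N\<close>.\<close>
  have "le B A"
    by (rule le_closed[of "\<lambda>k. A" "b \<circ> r \<circ> s"]) (use A B bA in auto)
  moreover have "le A B"
    by (rule le_closed[of "\<lambda>k. B" "a \<circ> r \<circ> s"]) (use A' B aB in auto)
  ultimately have "A = B" using le_antisym B by blast
  have "(\<lambda>n. f ((a \<circ> r \<circ> s) n)) \<longlonglongrightarrow> f A"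
    by (rule continuous_on_tendsto_compose[OF cont_f A']) (use A ab in auto)
  then have "f A \<in> M" using MN(1) ab(5) closed_sequentially[of M "\<lambda>n. f ((a \<circ> r \<circ> s) n)"] by auto
  have "(\<lambda>n. f ((b \<circ> r \<circ> s) n)) \<longlonglongrightarrow> f B"
    by (rule continuous_on_tendsto_compose[OF cont_f B(3)]) (use B ab in auto)
  then have "f B \<in> N" using MN(2) ab(6) closed_sequentially[of N "\<lambda>n. f ((b \<circ> r \<circ> s) n)"] by auto
  then show False using \<open>f A \<in> M\<close> \<open>A = B\<close> MN(3) by blast
qed

text \<open>A lift joining a point over \<open>M\<close> to one over \<open>N\<close>, inside
  \<open>P\<close> or inside \<open>Q\<close>, cannot run along one leg, as that would be a march.
  Both lifts therefore pass \<open>v\<close>, which puts \<open>f v\<close> into \<open>M\<close> or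
  \<open>N\<close>; but then going out from \<open>v\<close> is itself a march.\<close>

lemma hereditarily_unicoherent_Y: "hereditarily_unicoherent Y"
  unfolding hereditarily_unicoherent_def
proof (intro allI impI, rule ccontr)
  fix P Q assume a: "P \<subseteq> Y \<and> Q \<subseteq> Y \<and> continuum P \<and> continuum Q" and nc: "\<not> connected (P \<inter> Q)"
  have "closed (P \<inter> Q)" using a by (simp add: closed_Int compact_imp_closed continuum_def)
  then obtain M N where MN: "closed M" "closed N" "M \<inter> N = {}" "M \<noteq> {}" "N \<noteq> {}" "P \<inter> Q = M \<union> N"
    using nc unfolding connected_closed_set[OF \<open>closed (P \<inter> Q)\<close>] by metis
  have no: "\<not> march M N P x z" "\<not> march N M P x z" "\<not> march M N Q x z" "\<not> march N M Q x z" for x z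
    using no_march[of P Q M N] no_march[of P Q N M] no_march[of Q P M N] no_march[of Q P N M] a MN
    by (metis inf_commute sup_commute)+
  obtain m n where mn: "m \<in> M" "n \<in> N" using MN by blast
  then obtain x where x: "x \<in> X" "f x = m" using a MN onto by blast
  obtain z where z: "z \<in> X" "f z = n" "f ` S x z \<subseteq> P"
    using lift_seg[of x P n] a x mn MN by auto
  obtain z' where z': "z' \<in> X" "f z' = n" "f ` S x z' \<subseteq> Q"
    using lift_seg[of x Q n] a x mn MN by auto
  have "v \<in> S x z"
    using x(1) z(1)
  proof (cases rule: seg_cases)
    case 1
    then show ?thesis using no(1) unfolding march_def using x z mn by auto
  next
    case 2
    then show ?thesis using no(2)[of z x] unfolding march_def using x z mn seg_commute by auto
  qed
  have "v \<in> S x z'"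
    using x(1) z'(1)
  proof (cases rule: seg_cases)
    case 1
    then show ?thesis using no(3) unfolding march_def using x z' mn by auto
  next
    case 2
    then show ?thesis using no(4)[of z' x] unfolding march_def using x z' mn seg_commute by auto
  qed
  then have "f v \<in> M \<union> N" using \<open>v \<in> S x z\<close> z z' MN by blast
  moreover have "f ` S v z \<subseteq> P" "f ` S v x \<subseteq> P"
    using \<open>v \<in> S x z\<close> z x seg_split[of x z v] seg_commute by blast+
  ultimately show False
    using no(1)[of v z] no(2)[of v x] x z mn unfolding march_def by auto
qed

lemma dendroid_Y: "dendroid Y"
  unfolding dendroid_def arcwise_connected_def
proof (intro conjI ballI impI continuum_Y hereditarily_unicoherent_Y)
  fix y y' assume y: "y \<in> Y" "y' \<in> Y" "y \<noteq> y'"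
  then obtain x x' where x: "x \<in> X" "x' \<in> X" "f x = y" "f x' = y'" "x \<noteq> x'" using onto by blast
  then obtain g where g: "arc g" "path_image g \<subseteq> X" "pathstart g = x" "pathfinish g = x'"
    using seg_arc_obtain by metis
  have "path (f \<circ> g)"
    using g cont_f by (meson arc_imp_path continuous_on_subset path_continuous_image)
  moreover have "pathstart (f \<circ> g) = y" "pathfinish (f \<circ> g) = y'" "path_image (f \<circ> g) \<subseteq> Y"
    using g x onto by (auto simp: pathstart_compose pathfinish_compose path_image_compose)
  ultimately obtain q where "arc q" "path_image q \<subseteq> Y" "pathstart q = y" "pathfinish q = y'"
    using y(3) by (metis metric_path_contains_arc order_trans)
  then show "\<exists>q. arc q \<and> path_image q \<subseteq> Y \<and> pathstart q = y \<and> pathfinish q = y'" by blast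
qed

section \<open>Directions at an image point and their lifts\<close>

sublocale dY: dendroid_space Y
  using dendroid_Y by unfold_locales

lemma lift_arc:
  assumes "x \<in> X" "b \<in> Y"
  obtains u where "u \<in> X" "f u = b" "f ` S x u \<subseteq> dY.S (f x) b"
  using lift_seg[of x "dY.S (f x) b" b] dY.seg_continuum dY.seg_subset assms in_Y by auto

text \<open>The lifts avoid each other's ends because the arcs below meet only in
  \<open>f x\<close>. At most one goes outwards, since points above \<open>x\<close> are comparable.
  If none does, both pass \<open>v\<close> and contain \<open>S v x\<close>, whose image is then the
  common point: \<open>f\<close> collapses this initial part of the leg.\<close>

lemma two_directions:
  assumes x: "x \<in> X" "x \<noteq> v"
    and p: "p1 \<in> Y" "p2 \<in> Y" "dY.S (f x) p1 \<inter> dY.S (f x) p2 = {f x}" "p1 \<noteq> f x" "p2 \<noteq> f x"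
    and u: "u1 \<in> X" "f u1 = p1" "f ` S x u1 \<subseteq> dY.S (f x) p1"
      "u2 \<in> X" "f u2 = p2" "f ` S x u2 \<subseteq> dY.S (f x) p2"
  shows "le x u1 \<and> \<not> le x u2 \<or> le x u2 \<and> \<not> le x u1 \<or> \<not> le x u1 \<and> \<not> le x u2 \<and> f ` S v x \<subseteq> {f x}"
proof -
  have n: "u1 \<notin> S x u2" "u2 \<notin> S x u1"
    using p u dY.seg_ends(2) by (metis (no_types, lifting) Int_iff image_subset_iff singletonD)+
  have 1: "\<not> (le x u1 \<and> le x u2)"
    using le_upper_comparable[of x u1 u2] x u n seg_between by blast
  have "f ` S v x \<subseteq> {f x}" if no: "\<not> le x u1" "\<not> le x u2"
  proof -
    have a: "le u1 x \<or> v \<in> S x u1" "le u2 x \<or> v \<in> S x u2"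
      using seg_cases[of x u1] seg_cases[of x u2] no x u by metis+
    have "\<not> (le u1 x \<and> le u2 x)"
      using le_linear[of u1 x u2] seg_between n x seg_commute by metis
    moreover have "\<not> (le u1 x \<and> v \<in> S x u2)" "\<not> (le u2 x \<and> v \<in> S x u1)"
      using seg_inward_contains n x u by blast+
    ultimately have "v \<in> S x u1" "v \<in> S x u2" using a by blast+
    then have "S v x \<subseteq> S x u1" "S v x \<subseteq> S x u2"
      using seg_split(1) x u seg_commute by (metis Un_upper1)+
    then show ?thesis using u p(3) by blast
  qed
  then show ?thesis using 1 by blast
qed

text \<open>Three directions cannot be pairwise of opposite kinds, outward and not outward; so some
  pair falls under the collapsing alternative of \<open>two_directions\<close>.\<close>

lemma ramification_lift:
  assumes r: "ramification_point Y (f x)" and x: "x \<in> X" "x \<noteq> v"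
  shows "f ` S v x \<subseteq> {f x}"
proof -
  obtain a b c where t: "f x \<in> Y" "a \<in> Y" "b \<in> Y" "c \<in> Y" "a \<noteq> f x" "b \<noteq> f x" "c \<noteq> f x"
    "dY.S (f x) a \<inter> dY.S (f x) b = {f x}" "dY.S (f x) a \<inter> dY.S (f x) c = {f x}" "dY.S (f x) b \<inter> dY.S (f x) c = {f x}"
    using dY.ramification_point_triod[OF r] by metis
  obtain ua where ua: "ua \<in> X" "f ua = a" "f ` S x ua \<subseteq> dY.S (f x) a" using lift_arc x t by metis
  obtain ub where ub: "ub \<in> X" "f ub = b" "f ` S x ub \<subseteq> dY.S (f x) b" using lift_arc x t by metis
  obtain uc where uc: "uc \<in> X" "f uc = c" "f ` S x uc \<subseteq> dY.S (f x) c" using lift_arc x t by metis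
  show ?thesis
    using two_directions[OF x t(2,3,8,5,6) ua ub] two_directions[OF x t(2,4,9,5,7) ua uc]
      two_directions[OF x t(3,4,10,6,7) ub uc] by blast
qed

sublocale fY: fan_space Y "f v"
proof
  show "f v \<in> Y" using in_Y v_in by blast
  show "u = f v" if "ramification_point Y u" for u
  proof (rule ccontr)
    assume "u \<noteq> f v"
    obtain x where x: "x \<in> X" "f x = u"
      using dY.ramification_point_triod[OF \<open>ramification_point Y u\<close>] onto by blast
    then have "x \<noteq> v" using \<open>u \<noteq> f v\<close> by blast
    then have "f ` S v x \<subseteq> {u}" using ramification_lift that x by blast
    moreover have "v \<in> S v x" by simp
    ultimately show False using \<open>u \<noteq> f v\<close> by blast
  qed
qed

text \<open>No lift at an end point leads outwards, so an image strictly inside an arc forces the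
  collapsing alternative.\<close>

lemma end_point_image:
  assumes "e \<in> end_points X"
  shows "f e \<in> end_points Y \<or> f e = f v"
proof (rule ccontr)
  assume no: "\<not> ?thesis"
  have e: "e \<in> X" "e \<noteq> v" using assms end_points_iff[of e] v_not_end_point by auto
  obtain a b where ab: "a \<in> Y" "b \<in> Y" "f e \<in> dY.S a b" "f e \<noteq> a" "f e \<noteq> b"
    using no in_Y[OF e(1)] unfolding dY.end_points_iff by blast
  then have d: "dY.S (f e) a \<inter> dY.S (f e) b = {f e}" using dY.seg_split(2) dY.seg_commute by metis
  obtain u1 where u1: "u1 \<in> X" "f u1 = a" "f ` S e u1 \<subseteq> dY.S (f e) a" using lift_arc e ab by metis
  obtain u2 where u2: "u2 \<in> X" "f u2 = b" "f ` S e u2 \<subseteq> dY.S (f e) b" using lift_arc e ab by metis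
  have "\<not> le e u1" "\<not> le e u2" using end_point_max assms u1 u2 ab by metis+
  then have "f ` S v e \<subseteq> {f e}"
    using two_directions[OF e ab(1,2) d _ _ u1 u2] ab by metis
  moreover have "f v \<in> f ` S v e" by simp
  ultimately have "f v = f e" by blast
  then show False using no by simp
qed

end

lemma connected_nondegenerate_infinite:
  fixes Y :: "'b::metric_space set"
  assumes "connected Y" "nondegenerate Y"
  shows "infinite Y"
  using assms connected_finite_iff_sing unfolding nondegenerate_def
  by (metis empty_iff singletonD)

section \<open>Density, ramification and smoothness of the image\<close>

locale confluent_lelek_map = confluent_fan_map +
  assumes dense: "closure (end_points X) = X" and nondeg: "nondegenerate Y"
begin

lemma closed_Y: "closed Y" and connected_Y: "connected Y"
  using continuum_Y by (auto simp: continuum_def compact_imp_closed)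

text \<open>By \<open>end_point_image\<close>, \<open>f v\<close> is the only point the closure
  could miss; it would then be isolated and disconnect \<open>Y\<close>.\<close>

lemma dense_Y: "closure (end_points Y) = Y"
proof
  have sub: "end_points Y \<subseteq> Y" unfolding end_points_def by blast
  then show "closure (end_points Y) \<subseteq> Y" using closed_Y by (simp add: closure_minimal)
  have "Y \<subseteq> closure (f ` end_points X)"
  proof
    fix y assume "y \<in> Y"
    then obtain x where x: "x \<in> X" "f x = y" using onto by blast
    then obtain xs where xs: "\<And>n. xs n \<in> end_points X" "xs \<longlonglongrightarrow> x"
      using dense closure_sequential by metis
    have "xs n \<in> X" for n using xs(1)[of n] unfolding end_points_def by blast
    then have "(\<lambda>n. f (xs n)) \<longlonglongrightarrow> f x"
      using continuous_on_tendsto_compose[OF cont_f xs(2) x(1)] by simp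
    then show "y \<in> closure (f ` end_points X)"
      using xs x unfolding closure_sequential by (intro exI[of _ "\<lambda>n. f (xs n)"]) auto
  qed
  also have "\<dots> \<subseteq> closure (end_points Y \<union> {f v})"
    using end_point_image by (intro closure_mono) blast
  finally have Y: "Y \<subseteq> closure (end_points Y) \<union> {f v}" unfolding closure_Un by simp
  have "f v \<in> closure (end_points Y)"
  proof (rule ccontr)
    assume n: "f v \<notin> closure (end_points Y)"
    have "closed {f v}" "closed (closure (end_points Y))" by auto
    moreover have "{f v} \<inter> closure (end_points Y) \<inter> Y = {}" using n by blast
    moreover have "Y \<subseteq> {f v} \<union> closure (end_points Y)" using Y by blast
    moreover have "{f v} \<inter> Y \<noteq> {}" using fY.v_in by blast
    ultimately have "closure (end_points Y) \<inter> Y = {}"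
      using connected_Y unfolding connected_closed by blast
    then have "Y \<subseteq> {f v}" using Y by blast
    then show False using nondeg unfolding nondegenerate_def by blast
  qed
  then show "Y \<subseteq> closure (end_points Y)" using Y by blast
qed

text \<open>A finite set of end points would be closed and hence equal to the infinite set
  \<open>Y\<close>. Three end points other than \<open>f v\<close> are incomparable, so the arcs to
  them form a triod.\<close>

lemma ramification_fv: "ramification_point Y (f v)"
proof -
  have "infinite (end_points Y)"
  proof
    assume "finite (end_points Y)"
    then have "closure (end_points Y) = end_points Y" by (simp add: finite_imp_closed)
    then show False using dense_Y connected_nondegenerate_infinite[OF connected_Y nondeg] \<open>finite (end_points Y)\<close> by simp
  qed
  then have "infinite (end_points Y - {f v})" by simp
  then obtain T where T: "T \<subseteq> end_points Y - {f v}" "card T = 3" "finite T"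
    using infinite_arbitrarily_large by metis
  then obtain a b c where abc: "T = {a, b, c}" "a \<noteq> b" "b \<noteq> c" "a \<noteq> c"
    using card_3_iff by metis
  have disj: "dY.S (f v) p \<inter> dY.S (f v) q = {f v}" if "p \<in> T" "q \<in> T" "p \<noteq> q" for p q
  proof -
    have pq: "p \<in> end_points Y" "q \<in> end_points Y" "p \<noteq> f v" "q \<noteq> f v" "p \<in> Y" "q \<in> Y"
      using T that unfolding end_points_def by blast+
    have "\<not> fY.le p q" "\<not> fY.le q p"
      using fY.end_point_maximal pq that by metis+
    then show ?thesis using fY.fan_cases pq by blast
  qed
  have "T \<subseteq> Y" "f v \<notin> T" using T unfolding end_points_def by blast+
  then show ?thesis
    using dY.seg_triod_ramification[of "f v" a b c] disj[of a b] disj[of a c] disj[of b c] abc fY.v_in by auto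
qed

text \<open>Once \<open>f v\<close> is known to ramify, \<open>ramification_lift\<close> applies to
  all points over it: their set is a union of arcs from \<open>v\<close>.\<close>

lemma preimage_top: "z \<in> X \<Longrightarrow> f z = f v \<Longrightarrow> f ` S v z \<subseteq> {f v}"
  using ramification_lift[of z] ramification_fv v_in by (cases "z = v") auto

lemma preimage_top_le: "le p z \<Longrightarrow> z \<in> X \<Longrightarrow> f z = f v \<Longrightarrow> f p = f v"
  using preimage_top unfolding le_def by blast

text \<open>Otherwise the arc from \<open>f x\<close> to \<open>f v\<close> lifts at
  \<open>x\<close> to an arc that avoids \<open>p\<close> and ends over \<open>f v\<close>. Wherever
  it ends, it must cross \<open>p\<close>, or \<open>preimage_top_le\<close> makes
  \<open>f p\<close> or \<open>f x\<close> the top.\<close>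

lemma f_mono:
  assumes px: "le p x" and x: "x \<in> X"
  shows "fY.le (f p) (f x)"
proof (rule ccontr)
  assume n: "\<not> ?thesis"
  have p: "p \<in> X" using px x le_in by blast
  have pw: "f p \<noteq> f v" using n by auto
  then have xw: "f x \<noteq> f v" using preimage_top_le px x by blast
  obtain u where u: "u \<in> X" "f u = f v" "f ` S x u \<subseteq> dY.S (f x) (f v)"
    using lift_arc x fY.v_in by metis
  have "f p \<notin> dY.S (f x) (f v)" using n dY.seg_commute unfolding fY.le_def by metis
  then have pn: "p \<notin> S x u" using u by blast
  show False using x u(1)
  proof (cases rule: seg_cases)
    case 1
    then show ?thesis using preimage_top_le u xw by blast
  next
    case 2
    then have "le p u \<or> le u p" using le_linear px x by blast
    then show ?thesis using preimage_top_le u pw seg_between[OF _ px x] pn seg_commute by metis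
  next
    case 3
    then show ?thesis using seg_inward_contains px x u pn by blast
  qed
qed

lemma f_seg:
  assumes "x \<in> X" shows "f ` S v x = dY.S (f v) (f x)"
proof
  show "f ` S v x \<subseteq> dY.S (f v) (f x)"
    using f_mono assms unfolding le_def fY.le_def by blast
  have "S v x \<subseteq> X" "continuum (S v x)" using seg_subset seg_continuum v_in assms by blast+
  moreover have "continuum (f ` S v x)"
    using cont_f calculation unfolding continuum_def
    by (metis compact_continuous_image connected_continuous_image continuous_on_subset image_is_empty)
  moreover have "f ` S v x \<subseteq> Y" using \<open>S v x \<subseteq> X\<close> onto by blast
  ultimately show "dY.S (f v) (f x) \<subseteq> f ` S v x"
    by (intro dY.seg_least) auto
qed

text \<open>Suppose the Hausdorff distances stay above \<open>e\<close> along a subsequence.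
  Preimages of its terms accumulate in \<open>X\<close>, smoothness there makes their arcs converge,
  and \<open>f_seg\<close> carries this to \<open>Y\<close>.\<close>

lemma smooth_Y:
  assumes ys: "\<And>n. ys n \<in> Y" "y \<in> Y" "ys \<longlonglongrightarrow> y"
  shows "(\<lambda>n. hausdorff_dist (dY.S (f v) (ys n)) (dY.S (f v) y)) \<longlonglongrightarrow> 0"
proof (rule ccontr)
  let ?h = "\<lambda>y'. hausdorff_dist (dY.S (f v) y') (dY.S (f v) y)"
  assume "\<not> (\<lambda>n. ?h (ys n)) \<longlonglongrightarrow> 0"
  then obtain e where e: "e > 0" "\<exists>\<^sub>F n in sequentially. e \<le> dist (?h (ys n)) 0"
    unfolding tendsto_iff not_all not_imp frequently_def by (auto simp: not_le)
  then have "infinite {n. e \<le> dist (?h (ys n)) 0}"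
    by (simp add: frequently_cofinite cofinite_eq_sequentially[symmetric])
  then obtain r :: "nat \<Rightarrow> nat" where r: "strict_mono r" "\<And>n. e \<le> dist (?h (ys (r n))) 0"
    using infinite_enumerate by blast
  have "\<forall>n. \<exists>x\<in>X. f x = ys (r n)" using ys onto by (metis image_iff)
  then obtain xs where xs: "\<And>n. xs n \<in> X" "\<And>n. f (xs n) = ys (r n)" by metis
  obtain x s where x: "x \<in> X" "strict_mono s" "(xs \<circ> s) \<longlonglongrightarrow> x"
    using compact_X xs(1) unfolding compact_def by meson
  have "(\<lambda>n. f ((xs \<circ> s) n)) \<longlonglongrightarrow> f x"
    using continuous_on_tendsto_compose[OF cont_f x(3,1)] xs by simp
  moreover have "(\<lambda>n. f ((xs \<circ> s) n)) \<longlonglongrightarrow> y"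
    using LIMSEQ_subseq_LIMSEQ[OF LIMSEQ_subseq_LIMSEQ[OF ys(3) r(1)] x(2)] xs by (simp add: comp_def)
  ultimately have fx: "f x = y" using LIMSEQ_unique by blast
  have S: "S v z \<subseteq> X" "compact (S v z)" "S v z \<noteq> {}" if "z \<in> X" for z
    using seg_subset seg_continuum v_in that continuum_def by blast+
  have "(\<lambda>n. hausdorff_dist (S v ((xs \<circ> s) n)) (S v x)) \<longlonglongrightarrow> 0"
    by (rule smooth[OF _ x(1,3)]) (simp add: xs)
  then have "(\<lambda>n. hausdorff_dist (f ` S v ((xs \<circ> s) n)) (f ` S v x)) \<longlonglongrightarrow> 0"
    using S xs x by (intro hausdorff_dist_image_tendsto[OF cont_f compact_X]) auto
  then have "(\<lambda>n. ?h (ys (r (s n)))) \<longlonglongrightarrow> 0"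
    using f_seg xs x fx by simp
  then have "\<forall>\<^sub>F n in sequentially. dist (?h (ys (r (s n)))) 0 < e"
    using e(1) tendstoD by blast
  then obtain n where "dist (?h (ys (r (s n)))) 0 < e"
    using eventually_happens by force
  then show False using r(2)[of "s n"] by linarith
qed

lemma lelek_fan_Y: "lelek_fan Y"
  unfolding lelek_fan_def smooth_fan_def fan_def
proof (intro conjI exI[of _ "f v"] allI impI)
  fix xs :: "nat \<Rightarrow> 'b" and x As A
  assume a: "(\<forall>n. xs n \<in> Y) \<and> x \<in> Y \<and> xs \<longlonglongrightarrow> x \<and>
            (\<forall>n. arc_in Y (f v) (xs n) (As n)) \<and> arc_in Y (f v) x A"
  then have "As n = dY.S (f v) (xs n)" "A = dY.S (f v) x" for n
    using dY.arc_in_iff fY.v_in by blast+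
  then show "(\<lambda>n. hausdorff_dist (As n) A) \<longlonglongrightarrow> 0" using smooth_Y a by simp
next
  fix u u' assume "ramification_point Y u \<and> ramification_point Y u'"
  then show "u = u'" using fY.ram by metis
qed (use dendroid_Y ramification_fv dense_Y in auto)

end

lemma confluent_image_lelek_fan:
  assumes "lelek_fan L" "confluent L f" "f ` L = Y" "continuum Y" "nondegenerate Y"
  shows "lelek_fan Y"
proof -
  obtain v where "smooth_fan_space L v"
    using assms(1) smooth_fan_spaceI unfolding lelek_fan_def by blast
  then interpret smooth_fan_space L v .
  interpret confluent_lelek_map L v f Y
    using assms by unfold_locales (auto simp: lelek_fan_def)
  show ?thesis by (rule lelek_fan_Y)
qed

section \<open>Length functions and sectors\<close>

text \<open>For closed \<open>X\<close>, these are the relatively clopen subsets of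
  \<open>X - {v}\<close>, phrased in the ambient topology: such a set is open in \<open>X\<close>
  and can accumulate outside itself only at \<open>v\<close>.\<close>

definition sector :: "'a::metric_space set \<Rightarrow> 'a \<Rightarrow> 'a set \<Rightarrow> bool" where
  "sector X v A \<longleftrightarrow> A \<subseteq> X - {v} \<and> closed (insert v A) \<and> closed (X - A)"

text \<open>Legs do not occur explicitly: two points lie on the same leg iff no sector separates them.
  The assumption \<open>peaks\<close> is the density of end points, a peak being a point of maximal
  \<open>\<phi>\<close> on its leg.\<close>

locale sectored_space =
  fixes X :: "'a::metric_space set" and v :: 'a and \<phi> :: "'a \<Rightarrow> real"
  assumes compact: "compact X" and top_in: "v \<in> X" and nontrivial: "X \<noteq> {v}"
    and cont: "continuous_on X \<phi>" and nonneg: "\<And>x. x \<in> X \<Longrightarrow> 0 \<le> \<phi> x"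
    and zero_iff: "\<And>x. x \<in> X \<Longrightarrow> \<phi> x = 0 \<longleftrightarrow> x = v"
    and separates: "\<And>x y. x \<in> X - {v} \<Longrightarrow> y \<in> X - {v} \<Longrightarrow> x \<noteq> y \<Longrightarrow> \<phi> x = \<phi> y \<Longrightarrow>
      \<exists>A. sector X v A \<and> x \<in> A \<and> y \<notin> A"
    and below: "\<And>x t. x \<in> X - {v} \<Longrightarrow> 0 < t \<Longrightarrow> t \<le> \<phi> x \<Longrightarrow>
      \<exists>y\<in>X. \<phi> y = t \<and> (\<forall>A. sector X v A \<longrightarrow> x \<in> A \<longrightarrow> y \<in> A)"
    and peaks: "\<And>x e. x \<in> X - {v} \<Longrightarrow> 0 < e \<Longrightarrow>
      \<exists>p\<in>X - {v}. dist x p < e \<and> (\<forall>y\<in>X - {v}. \<phi> p < \<phi> y \<longrightarrow> (\<exists>A. sector X v A \<and> p \<in> A \<and> y \<notin> A))"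

lemma compact_dense_sequence:
  fixes X :: "'a::metric_space set"
  assumes "compact X" "X \<noteq> {}"
  obtains q :: "nat \<Rightarrow> 'a" where "\<And>x e. x \<in> X \<Longrightarrow> 0 < e \<Longrightarrow> \<exists>n. dist x (q n) < e"
proof -
  have "\<exists>k. finite k \<and> X \<subseteq> (\<Union>x\<in>k. ball x (inverse (Suc n)))" for n
    using assms(1) unfolding compact_eq_totally_bounded by simp
  then obtain k where k: "\<And>n. finite (k n)" "\<And>n. X \<subseteq> (\<Union>x\<in>k n. ball x (inverse (Suc n)))" by metis
  define C where "C = (\<Union>n. k n)"
  have "countable C" unfolding C_def using k by (simp add: countable_finite)
  have "C \<noteq> {}" using k(2)[of 0] assms(2) unfolding C_def by blast
  show thesis
  proof (rule that[of "from_nat_into C"])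
    fix x e assume x: "x \<in> X" "(0::real) < e"
    then obtain n where n: "inverse (real (Suc n)) < e" using reals_Archimedean by blast
    then obtain c where "c \<in> k n" "dist c x < inverse (Suc n)" using k(2)[of n] x by auto
    then have "c \<in> C" "dist x c < e" using n unfolding C_def by (auto simp: dist_commute)
    then show "\<exists>n. dist x (from_nat_into C n) < e"
      using from_nat_into_surj[OF \<open>countable C\<close>] by metis
  qed
qed

section \<open>A strictly increasing length on a smooth fan\<close>

context smooth_fan_space
begin

lemma seg_compact: "x \<in> X \<Longrightarrow> compact (S v x)" "x \<in> X \<Longrightarrow> S v x \<noteq> {}"
  using seg_continuum v_in continuum_def by blast+

lemma continuous_infdist_seg: "continuous_on X (\<lambda>x. infdist q (S v x))"
proof (rule continuous_on_sequentiallyI)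
  fix u a assume u: "\<forall>n. u n \<in> X" "a \<in> X" "u \<longlonglongrightarrow> a"
  have "norm (infdist q (S v (u n)) - infdist q (S v a)) \<le> hausdorff_dist (S v (u n)) (S v a)" for n
    using infdist_diff_le_hausdorff_dist[of "S v (u n)" "S v a" q] u seg_compact by simp
  then have "\<forall>\<^sub>F n in sequentially. norm (infdist q (S v (u n)) - infdist q (S v a)) \<le> hausdorff_dist (S v (u n)) (S v a)"
    by simp
  then have "(\<lambda>n. infdist q (S v (u n)) - infdist q (S v a)) \<longlonglongrightarrow> 0"
    by (rule Lim_null_comparison[OF _ smooth[OF spec[OF u(1)] u(2,3)]])
  then show "(\<lambda>n. infdist q (S v (u n))) \<longlonglongrightarrow> infdist q (S v a)"
    by (rule LIM_zero_cancel)
qed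

text \<open>The distance of \<open>q\<close> to the arc from \<open>v\<close> to \<open>x\<close> decreases along legs, and it drops strictly
  when \<open>x\<close> comes close to \<open>q\<close>; summing over a dense sequence of \<open>q\<close> gives strictness everywhere.\<close>

lemma length_function:
  "\<exists>\<phi> :: 'a \<Rightarrow> real. continuous_on X \<phi> \<and> \<phi> v = 0 \<and> (\<forall>x y. y \<in> X \<longrightarrow> le x y \<longrightarrow> x \<noteq> y \<longrightarrow> \<phi> x < \<phi> y)"
proof -
  obtain q :: "nat \<Rightarrow> 'a" where q0: "\<And>x e. x \<in> X \<Longrightarrow> 0 < e \<Longrightarrow> \<exists>n. dist x (q n) < e"
    using compact_dense_sequence[OF compact_X] v_in by blast
  define g where "g n x = dist (q n) v - infdist (q n) (S v x)" for n x
  \<comment> \<open>The weights give uniform convergence; the added 1 keeps the denominator positive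
    when \<open>q n\<close> is \<open>v\<close>.\<close>
  define h where "h n x = (1/2)^n * (g n x / (1 + dist (q n) v))" for n x
  have g0: "0 \<le> g n x" "g n x \<le> 1 + dist (q n) v" for n x
    unfolding g_def using infdist_le[of v "S v x" "q n"] infdist_nonneg[of "q n" "S v x"] by auto
  have gm: "g n x \<le> g n y" if "y \<in> X" "le x y" for n x y
    unfolding g_def using infdist_mono[OF le_subset[OF that(2,1)]] seg_ends(1) by fastforce
  have hb: "norm (h n x) \<le> (1/2)^n" for n x
    unfolding h_def using g0[of n x] by (simp add: divide_le_eq add_pos_nonneg mult_left_le)
  have sm: "summable (\<lambda>n. (1/2)^n :: real)" by (simp add: summable_geometric)
  then have smh: "summable (\<lambda>n. h n x)" for x
    using hb by (metis summable_comparison_test')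
  have "uniform_limit X (\<lambda>n x. \<Sum>i<n. h i x) (\<lambda>x. \<Sum>i. h i x) sequentially"
    using hb sm by (intro Weierstrass_m_test) auto
  moreover have "continuous_on X (\<lambda>x. \<Sum>i<n. h i x)" for n
    unfolding h_def g_def by (intro continuous_intros continuous_infdist_seg) (use zero_le_dist in \<open>auto simp: add_nonneg_eq_0_iff\<close>)
  ultimately have c: "continuous_on X (\<lambda>x. \<Sum>i. h i x)"
    by (intro uniform_limit_theorem[OF always_eventually]) auto
  have "h n v = 0" for n unfolding h_def g_def using v_in by simp
  then have z: "(\<Sum>i. h i v) = 0" by simp
  have st: "(\<Sum>i. h i x) < (\<Sum>i. h i y)" if y: "y \<in> X" "le x y" "x \<noteq> y" for x y
  proof -
    have x: "x \<in> X" using y le_in by blast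
    have "y \<notin> S v x" using le_antisym y le_def by blast
    then have "infdist y (S v x) > 0"
      using seg_compact[OF x] infdist_nonneg[of y "S v x"]
      by (metis compact_imp_closed in_closed_iff_infdist_zero less_eq_real_def)
    \<comment> \<open>Within half that distance of \<open>y\<close>, \<open>q n\<close> is closer to
      \<open>S v y\<close> than to \<open>S v x\<close>.\<close>
    then obtain n where n: "dist y (q n) < infdist y (S v x) / 2" using q0[OF y(1)] by (metis half_gt_zero)
    have "infdist (q n) (S v y) \<le> dist y (q n)" using infdist_le[of y "S v y" "q n"] by (simp add: dist_commute)
    moreover have "infdist y (S v x) \<le> infdist (q n) (S v x) + dist y (q n)"
      by (metis infdist_triangle)
    ultimately have "g n x < g n y" unfolding g_def using n by linarith
    then have "h n x < h n y" unfolding h_def by (simp add: divide_strict_right_mono add_pos_nonneg)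
    moreover have "h i x \<le> h i y" for i
      unfolding h_def using gm[OF y(1,2)] by (simp add: divide_right_mono)
    ultimately have "0 < (\<Sum>i. h i y - h i x)"
      by (intro suminf_pos2[of _ n] summable_diff smh) auto
    then show ?thesis using suminf_diff[OF smh smh, of y x] by simp
  qed
  show ?thesis using c z st by (intro exI[of _ "\<lambda>x. \<Sum>i. h i x"]) simp
qed

end

section \<open>Sectors from clopen cuts of superlevel sets\<close>

locale graded_fan = smooth_fan_space +
  fixes \<phi> :: "'a \<Rightarrow> real"
  assumes cont_l: "continuous_on X \<phi>" and l_v: "\<phi> v = 0"
    and l_strict: "\<And>x y. y \<in> X \<Longrightarrow> le x y \<Longrightarrow> x \<noteq> y \<Longrightarrow> \<phi> x < \<phi> y"
begin

definition cmp :: "'a \<Rightarrow> 'a \<Rightarrow> bool" where "cmp x y \<longleftrightarrow> le x y \<or> le y x"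

lemma cmp_trans: "cmp x y \<Longrightarrow> cmp y z \<Longrightarrow> x \<in> X \<Longrightarrow> y \<in> X - {v} \<Longrightarrow> z \<in> X \<Longrightarrow> cmp x z"
  unfolding cmp_def using le_trans le_linear le_upper_comparable by (metis DiffE insertI1)

lemma l_mono: "y \<in> X \<Longrightarrow> le x y \<Longrightarrow> \<phi> x \<le> \<phi> y"
  using l_strict by fastforce

lemma l_pos: "x \<in> X \<Longrightarrow> x \<noteq> v \<Longrightarrow> 0 < \<phi> x"
  using l_strict[of x v] l_v by simp

text \<open>For positive \<open>s\<close> these sets are compact and miss \<open>v\<close>, so legs
  can be cut apart inside them; they exhaust \<open>X - {v}\<close> as \<open>s\<close> decreases to
  0.\<close>

definition Xs :: "real \<Rightarrow> 'a set" where "Xs s = {z \<in> X. s \<le> \<phi> z}"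

lemma Xs_sub: "Xs s \<subseteq> X" and v_notin_Xs: "0 < s \<Longrightarrow> v \<notin> Xs s"
  unfolding Xs_def using l_v by auto

lemma compact_Xs: "compact (Xs s)"
proof -
  have "closed (X \<inter> \<phi> -` {s..})"
    using cont_l compact_X by (simp add: compact_imp_closed continuous_closed_preimage)
  then have "compact (X \<inter> (X \<inter> \<phi> -` {s..}))" using compact_X compact_Int_closed by blast
  moreover have "X \<inter> (X \<inter> \<phi> -` {s..}) = Xs s" unfolding Xs_def by auto
  ultimately show ?thesis by simp
qed

definition split :: "real \<Rightarrow> 'a set \<Rightarrow> 'a set \<Rightarrow> bool" where
  "split s T U \<longleftrightarrow> closed T \<and> closed U \<and> T \<union> U = Xs s \<and> T \<inter> U = {}"

text \<open>By the cut wire theorem a clopen cut exists unless a connected subset of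
  \<open>Xs s\<close> meets both sets. Its closure would contain the arc between the two points, and
  an arc missing \<open>v\<close> joins only comparable points.\<close>

lemma split_exists:
  assumes s: "0 < s" and P: "closed P" "closed P'" "P \<subseteq> Xs s" "P' \<subseteq> Xs s"
    and n: "\<And>p p'. p \<in> P \<Longrightarrow> p' \<in> P' \<Longrightarrow> \<not> cmp p p'"
  obtains T U where "split s T U" "P \<subseteq> T" "P' \<subseteq> U"
proof -
  have "separated_between (top_of_set (Xs s)) P P'"
  proof (rule cut_wire_fence_theorem)
    show "compact_space (top_of_set (Xs s))" using compact_Xs[of s] by (simp add: compact_space_subtopology)
    show "Hausdorff_space (top_of_set (Xs s))" by (simp add: Hausdorff_space_subtopology)
    show "closedin (top_of_set (Xs s)) P" "closedin (top_of_set (Xs s)) P'"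
      using P by (auto simp: closed_subset)
    fix C assume C: "connectedin (top_of_set (Xs s)) C"
    show "disjnt C P \<or> disjnt C P'"
    proof (rule ccontr)
      assume "\<not> ?thesis"
      then obtain p p' where p: "p \<in> C" "p \<in> P" "p' \<in> C" "p' \<in> P'" unfolding disjnt_def by blast
      have "connected C" "C \<subseteq> Xs s" using C by (auto simp: connectedin_subtopology)
      then have "closure C \<subseteq> Xs s" "connected (closure C)"
        using compact_Xs by (simp_all add: closure_minimal compact_imp_closed connected_imp_connected_closure)
      moreover have "compact (closure C)"
        using compact_Int_closed[OF compact_Xs, of "closure C" s] calculation by (simp add: Int_absorb1)
      moreover have pc: "p \<in> closure C" "p' \<in> closure C" using p closure_subset by (meson subsetD)+
      ultimately have "continuum (closure C)" "closure C \<subseteq> X" "closure C \<subseteq> Xs s"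
        unfolding continuum_def using Xs_sub[of s] by auto
      then have "S p p' \<subseteq> Xs s"
        using seg_least[OF _ _ pc] by (meson order_trans)
      then have "v \<notin> S p p'" using v_notin_Xs s by blast
      then show False using not_between_imp_v n p P Xs_sub unfolding cmp_def by blast
    qed
  qed
  then obtain T U where TU: "closedin (top_of_set (Xs s)) T" "closedin (top_of_set (Xs s)) U"
    "T \<union> U = Xs s" "disjnt T U" "P \<subseteq> T" "P' \<subseteq> U"
    unfolding separated_between_alt by auto
  have "closed (Xs s)" using compact_Xs compact_imp_closed by blast
  then show thesis using that[of T U] TU unfolding split_def disjnt_def
    using closedin_closed_trans by blast
qed

lemma connected_split:
  assumes "connected C" "C \<subseteq> T \<union> U" "closed T" "closed U" "C \<inter> T \<inter> U = {}" "x \<in> C" "y \<in> C" "x \<in> T"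
  shows "y \<in> T"
  using assms unfolding connected_closed by blast

text \<open>Between comparable points \<open>\<phi>\<close> does not fall below the smaller end
  value, so their arc stays in \<open>Xs s\<close>, and a clopen cut cannot divide it.\<close>

lemma split_saturated:
  assumes s: "0 < s" and TU: "split s T U" and p: "p \<in> T" "p' \<in> U"
  shows "\<not> cmp p p'"
proof
  assume c: "cmp p p'"
  have pX: "p \<in> Xs s" "p' \<in> Xs s" using TU p unfolding split_def by blast+
  then have X: "p \<in> X" "p' \<in> X" using Xs_sub by blast+
  have "S p p' \<subseteq> Xs s"
  proof
    fix q assume q: "q \<in> S p p'"
    then have "q \<in> X" using seg_subset X by blast
    moreover have "le p q \<or> le p' q" using c le_seg(1) q X seg_commute unfolding cmp_def by metis
    then have "s \<le> \<phi> q" using l_mono[OF \<open>q \<in> X\<close>] pX unfolding Xs_def by fastforce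
    ultimately show "q \<in> Xs s" unfolding Xs_def by blast
  qed
  moreover have "connected (S p p')" using seg_continuum X continuum_def by blast
  ultimately have "p' \<in> T"
    using connected_split[of "S p p'" T U p p'] TU p unfolding split_def by auto
  then show False using TU p unfolding split_def by blast
qed

lemma closed_down:
  assumes "closed T" "T \<subseteq> X"
  shows "closed {z \<in> Xs s. \<exists>t\<in>T. le z t}"
  unfolding closed_sequential_limits
proof (intro allI impI)
  fix z l assume a: "(\<forall>n. z n \<in> {z \<in> Xs s. \<exists>t\<in>T. le z t}) \<and> z \<longlonglongrightarrow> l"
  then have "\<forall>n. \<exists>t. t \<in> T \<and> le (z n) t" by blast
  then obtain t where t: "\<And>n. t n \<in> T" "\<And>n. le (z n) (t n)" by metis
  have "compact T" using compact_Int_closed[OF compact_X assms(1)] assms(2) by (simp add: Int_absorb1)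
  then obtain u r where u: "u \<in> T" "strict_mono r" "(t \<circ> r) \<longlonglongrightarrow> u"
    using t(1) unfolding compact_def by meson
  have "le l u"
  proof (rule le_closed[of "t \<circ> r" "z \<circ> r"])
    show "(z \<circ> r) \<longlonglongrightarrow> l" using a u(2) LIMSEQ_subseq_LIMSEQ by blast
  qed (use t assms(2) u in auto)
  moreover have "l \<in> Xs s"
    using a compact_Xs[of s] closed_sequentially[of "Xs s" z l] compact_imp_closed by blast
  ultimately show "l \<in> {z \<in> Xs s. \<exists>t\<in>T. le z t}" using u by blast
qed

text \<open>The downward closures of both halves in the lower level are closed because the order is,
  and no leg meets both because comparability is transitive off \<open>v\<close>. Separating them
  extends the cut.\<close>

lemma split_extend:
  assumes s: "0 < s'" "s' \<le> s" and TU: "split s T U"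
  obtains T' U' where "split s' T' U'" "T \<subseteq> T'" "U \<subseteq> U'"
proof -
  have XT: "T \<subseteq> Xs s" "U \<subseteq> Xs s" "closed T" "closed U" using TU unfolding split_def by blast+
  have sub: "Xs s \<subseteq> Xs s'" using s unfolding Xs_def by auto
  let ?P = "\<lambda>T. {z \<in> Xs s'. \<exists>t\<in>T. le z t}"
  obtain T' U' where TU': "split s' T' U'" "?P T \<subseteq> T'" "?P U \<subseteq> U'"
  proof (rule split_exists[OF s(1)])
    show "closed (?P T)" "closed (?P U)" using closed_down XT Xs_sub by blast+
    fix p p' assume p: "p \<in> ?P T" "p' \<in> ?P U"
    then obtain t u where t: "t \<in> T" "le p t" "u \<in> U" "le p' u" by blast
    have X: "p \<in> X - {v}" "p' \<in> X - {v}" "t \<in> X - {v}" "u \<in> X - {v}"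
      using p t XT Xs_sub v_notin_Xs s by (blast, blast, auto)
    show "\<not> cmp p p'"
    proof
      assume "cmp p p'"
      moreover have "cmp t p" "cmp p' u" using t unfolding cmp_def by blast+
      ultimately have "cmp t u" using cmp_trans X by blast
      then show False using split_saturated[OF _ TU t(1,3)] s by simp
    qed
  qed auto
  have "T \<subseteq> ?P T" "U \<subseteq> ?P U" using XT sub le_refl by blast+
  then show thesis using that[OF TU'(1)] TU'(2,3) by (meson order_trans)
qed

text \<open>Cuts of the levels \<open>s / 2^n\<close>, each extending the previous one, unite to a
  partition of \<open>X - {v}\<close>. A limit other than \<open>v\<close> has positive length, so a
  tail of the sequence lies in one level and is caught by the closed half there.\<close>

lemma sector_separates:
  assumes x: "x \<in> X - {v}" "y \<in> X - {v}" "\<not> cmp x y"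
  obtains A where "sector X v A" "x \<in> A" "y \<notin> A"
proof -
  define s where "s = min (\<phi> x) (\<phi> y)"
  have s: "s > 0" using l_pos x unfolding s_def by auto
  have xy: "x \<in> Xs s" "y \<in> Xs s" using x unfolding s_def Xs_def by auto
  obtain T0 U0 where 0: "split s T0 U0" "{x} \<subseteq> T0" "{y} \<subseteq> U0"
    using split_exists[OF s, of "{x}" "{y}"] xy x by auto
  define R where "R n p \<longleftrightarrow> split (s / 2^n) (fst p) (snd p) \<and> x \<in> fst p \<and> y \<in> snd p" for n :: nat and p
  obtain F where F: "\<And>n. R n (F n)" "\<And>n. fst (F n) \<subseteq> fst (F (Suc n)) \<and> snd (F n) \<subseteq> snd (F (Suc n))"
  proof -
    have "\<exists>p. R 0 p" using 0 unfolding R_def by (intro exI[of _ "(T0, U0)"]) auto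
    moreover have "\<exists>p'. R (Suc n) p' \<and> fst p \<subseteq> fst p' \<and> snd p \<subseteq> snd p'" if R: "R n p" for n p
    proof -
      have "0 < s / 2 ^ Suc n" "s / 2 ^ Suc n \<le> s / 2 ^ n" using s by (auto simp: field_simps)
      then obtain T' U' where "split (s / 2 ^ Suc n) T' U'" "fst p \<subseteq> T'" "snd p \<subseteq> U'"
        using split_extend R unfolding R_def by metis
      then show ?thesis using R unfolding R_def by (intro exI[of _ "(T', U')"]) auto
    qed
    ultimately show thesis
      using that dependent_nat_choice[of R "\<lambda>n p p'. fst p \<subseteq> fst p' \<and> snd p \<subseteq> snd p'"] by metis
  qed
  define T U where "T n = fst (F n)" and "U n = snd (F n)" for n
  have sp: "closed (T n)" "closed (U n)" "T n \<union> U n = Xs (s / 2^n)" "T n \<inter> U n = {}" "x \<in> T n" "y \<in> U n" for n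
    using F(1)[of n] unfolding R_def split_def T_def U_def by auto
  have mono: "T n \<subseteq> T m" "U n \<subseteq> U m" if "n \<le> m" for n m
    using lift_Suc_mono_le[of T n m] lift_Suc_mono_le[of U n m] F(2) that unfolding T_def U_def by blast+
  define A B where "A = (\<Union>n. T n)" and "B = (\<Union>n. U n)"
  have AB: "A \<inter> B = {}"
  proof -
    have "z \<notin> U m" if "z \<in> T n" for z n m
      using mono[of n "max n m"] mono[of m "max n m"] sp(4)[of "max n m"] that by auto
    then show ?thesis unfolding A_def B_def by blast
  qed
  have small: "\<exists>n. s / 2^n < e" if "e > 0" for e
  proof -
    obtain n where "(1/2)^n < e / s" using real_arch_pow_inv[of "e/s" "1/2"] s \<open>e > 0\<close> by auto
    then show ?thesis using s by (intro exI[of _ n]) (simp add: field_simps power_divide)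
  qed
  have cover: "A \<union> B = X - {v}"
  proof
    have "v \<notin> Xs (s / 2^n)" for n using v_notin_Xs s by simp
    then show "A \<union> B \<subseteq> X - {v}"
      unfolding A_def B_def using sp(3) Xs_sub by blast
    show "X - {v} \<subseteq> A \<union> B"
    proof
      fix z assume z: "z \<in> X - {v}"
      then obtain n where "s / 2^n < \<phi> z" using small l_pos by blast
      then have "z \<in> Xs (s / 2^n)" using z unfolding Xs_def by auto
      then show "z \<in> A \<union> B" using sp(3) unfolding A_def B_def by blast
    qed
  qed
  have clos: "closed (insert v A)" if A: "A = (\<Union>n. T n)" "A \<inter> B = {}" "A \<union> B = X - {v}" "B = (\<Union>n. U n)"
    and T: "\<And>n. closed (T n)" "\<And>n. T n \<union> U n = Xs (s / 2^n)" for A B T U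
    unfolding closed_sequential_limits
  proof (intro allI impI)
    fix a l assume a: "(\<forall>n. a n \<in> insert v A) \<and> a \<longlonglongrightarrow> l"
    then have aX: "a n \<in> X" for n using A v_in by (metis DiffD1 UnI1 insertE)
    then have lX: "l \<in> X" using a compact_X closed_sequentially compact_imp_closed by blast
    show "l \<in> insert v A"
    proof (cases "l = v")
      case False
      then obtain n where n: "s / 2^n < \<phi> l" using small l_pos lX by blast
      have "(\<lambda>k. \<phi> (a k)) \<longlonglongrightarrow> \<phi> l" 
        by (rule continuous_on_tendsto_compose[OF cont_l _ lX]) (use a aX in auto)
      then have "\<forall>\<^sub>F k in sequentially. s / 2^n < \<phi> (a k)" using n order_tendstoD(1) by blast
      then have "\<forall>\<^sub>F k in sequentially. a k \<in> T n"
      proof eventually_elim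
        case (elim k)
        then have "a k \<in> Xs (s / 2^n)" "a k \<noteq> v" using aX s l_v unfolding Xs_def
          by (auto simp: field_simps)
        then have "a k \<in> A" "a k \<notin> B" "a k \<in> T n \<union> U n" using T(2)[of n] a A(2) by auto
        then show ?case using A(4) by blast
      qed
      then have "l \<in> T n" using Lim_in_closed_set[OF T(1)] a by (metis sequentially_bot)
      then show ?thesis using A by blast
    qed simp
  qed
  have "closed (insert v A)"
    using clos[of A T B U] A_def B_def AB cover sp by simp
  moreover have "closed (insert v B)"
    using clos[of B U A T] A_def B_def AB cover sp by (simp add: Un_commute Int_commute)
  moreover have "X - A = insert v B" using AB cover v_in by blast
  ultimately have "sector X v A" unfolding sector_def using cover by auto
  moreover have "x \<in> A" "y \<in> B" using sp(5,6)[of 0] unfolding A_def B_def by blast+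
  moreover have "y \<notin> A" using \<open>y \<in> B\<close> AB by blast
  ultimately show thesis using that by blast
qed

text \<open>The arc between comparable points other than \<open>v\<close> misses \<open>v\<close>,
  so a sector is clopen along it.\<close>

lemma sector_saturated:
  assumes A: "sector X v A" and x: "x \<in> A" "y \<in> X - {v}" "cmp x y"
  shows "y \<in> A"
proof -
  have xX: "x \<in> X - {v}" using A x unfolding sector_def by blast
  have "v \<notin> S x y"
    using le_seg(1)[of x y v] le_seg(1)[of y x v] x xX le_v_iff seg_commute unfolding cmp_def by auto
  moreover have "connected (S x y)" "S x y \<subseteq> X"
    using seg_continuum seg_subset x xX continuum_def by blast+
  ultimately have "y \<in> insert v A"
    using A x xX connected_split[of "S x y" "insert v A" "X - A" x y] unfolding sector_def by auto
  then show ?thesis using x by blast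
qed

lemma sectored:
  assumes dense: "closure (end_points X) = X"
  shows "sectored_space X v \<phi>"
proof
  show "compact X" "v \<in> X" "continuous_on X \<phi>" using compact_X v_in cont_l by auto
  show "X \<noteq> {v}" using ramification_point_triod[OF ram_v] by blast
  show "0 \<le> \<phi> x" "\<phi> x = 0 \<longleftrightarrow> x = v" if "x \<in> X" for x
    using l_pos[OF that] l_v by (cases "x = v"; auto)+
  show "\<exists>A. sector X v A \<and> x \<in> A \<and> y \<notin> A" if "x \<in> X - {v}" "y \<in> X - {v}" "x \<noteq> y" "\<phi> x = \<phi> y" for x y
  proof -
    have "\<not> cmp x y" using l_strict[of y x] l_strict[of x y] that unfolding cmp_def by auto
    then show ?thesis using sector_separates that by metis
  qed
  show "\<exists>y\<in>X. \<phi> y = t \<and> (\<forall>A. sector X v A \<longrightarrow> x \<in> A \<longrightarrow> y \<in> A)"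
    if x: "x \<in> X - {v}" "0 < t" "t \<le> \<phi> x" for x t
  proof -
    have sub: "S v x \<subseteq> X" "connected (S v x)" using seg_subset seg_continuum v_in x continuum_def by blast+
    then have "connected (\<phi> ` S v x)" using cont_l connected_continuous_image continuous_on_subset by blast
    moreover have "0 \<in> \<phi> ` S v x" "\<phi> x \<in> \<phi> ` S v x" using l_v by (metis imageI seg_ends)+
    ultimately have "t \<in> \<phi> ` S v x" using x connectedD_interval by (metis less_imp_le)
    then obtain y where y: "le y x" "\<phi> y = t" unfolding le_def by blast
    then have "y \<in> X - {v}" "cmp x y" using x le_in l_v unfolding cmp_def by auto
    then show ?thesis using y sector_saturated by blast
  qed
  show "\<exists>p\<in>X - {v}. dist x p < e \<and> (\<forall>y\<in>X - {v}. \<phi> p < \<phi> y \<longrightarrow> (\<exists>A. sector X v A \<and> p \<in> A \<and> y \<notin> A))"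
    if x: "x \<in> X - {v}" "0 < e" for x and e :: real
  proof -
    obtain p where p: "p \<in> end_points X" "dist p x < e"
      using dense x closure_approachable[of x "end_points X"] by auto
    have pX: "p \<in> X - {v}" using p v_not_end_point unfolding end_points_def by blast
    have "\<exists>A. sector X v A \<and> p \<in> A \<and> y \<notin> A" if y: "y \<in> X - {v}" "\<phi> p < \<phi> y" for y
    proof -
      \<comment> \<open>A longer point is not below \<open>p\<close>, and nothing else lies above an
        end point; so \<open>y\<close> is on another leg.\<close>
      have "\<not> le y p" using l_mono[of p y] y pX by auto
      moreover have "\<not> le p y" using end_point_max[OF p(1)] y by auto
      ultimately show ?thesis using sector_separates[OF pX y(1)] unfolding cmp_def by metis
    qed
    then show ?thesis using p pX by (intro bexI[of _ p]) (auto simp: dist_commute)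
  qed
qed

end

lemma lelek_fan_sectored:
  assumes "lelek_fan X"
  obtains v \<phi> where "sectored_space X v \<phi>"
proof -
  obtain v where "smooth_fan_space X v"
    using assms smooth_fan_spaceI unfolding lelek_fan_def by blast
  then interpret smooth_fan_space X v .
  obtain \<phi> :: "'a \<Rightarrow> real" where "continuous_on X \<phi>" "\<phi> v = 0" "\<And>x y. y \<in> X \<Longrightarrow> le x y \<Longrightarrow> x \<noteq> y \<Longrightarrow> \<phi> x < \<phi> y"
    using length_function by metis
  then interpret graded_fan X v \<phi> by unfold_locales auto
  show thesis using that sectored assms lelek_fan_def by blast
qed

section \<open>Matching sectors\<close>

definition height :: "('a \<Rightarrow> real) \<Rightarrow> 'a set \<Rightarrow> real" where
  "height \<phi> A = (SUP x\<in>A. \<phi> x)"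

lemma sector_Int:
  assumes "sector X v A" "sector X v B"
  shows "sector X v (A \<inter> B)"
proof -
  have "insert v (A \<inter> B) = insert v A \<inter> insert v B" "X - A \<inter> B = (X - A) \<union> (X - B)" by blast+
  then have "closed (insert v (A \<inter> B))" "closed (X - A \<inter> B)"
    using assms unfolding sector_def by (metis closed_Int, metis closed_Un)
  then show ?thesis using assms unfolding sector_def by blast
qed

lemma sector_Diff:
  assumes "sector X v A" "sector X v B" "v \<in> X"
  shows "sector X v (A - B)"
proof -
  have "insert v (A - B) = insert v A \<inter> (X - B)" "X - (A - B) = (X - A) \<union> insert v B"
    using assms unfolding sector_def by blast+
  then have "closed (insert v (A - B))" "closed (X - (A - B))"
    using assms unfolding sector_def by (metis closed_Int, metis closed_Un)
  then show ?thesis using assms unfolding sector_def by blast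
qed

section \<open>Heights of sectors and countable separation\<close>

context sectored_space
begin

lemma closed_X: "closed X" using compact compact_imp_closed by blast

lemma sector_whole: "sector X v (X - {v})"
proof -
  have "insert v (X - {v}) = X" "X - (X - {v}) = {v}" using top_in by auto
  then show ?thesis unfolding sector_def using closed_X by simp
qed

lemma sector_empty: "sector X v {}"
  unfolding sector_def using closed_X by simp

lemma positive: "x \<in> X - {v} \<Longrightarrow> 0 < \<phi> x"
  using nonneg[of x] zero_iff[of x] by force

lemma sector_Inter:
  assumes "finite D" "sector X v A" "\<And>y. y \<in> D \<Longrightarrow> sector X v (B y)"
  shows "sector X v (A \<inter> (\<Inter>y\<in>D. B y))"
  using assms
proof (induction D rule: finite_induct)
  case (insert d D)
  then have "sector X v (A \<inter> (\<Inter>y\<in>D. B y))" "sector X v (B d)" by auto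
  then have "sector X v ((A \<inter> (\<Inter>y\<in>D. B y)) \<inter> B d)" by (rule sector_Int)
  moreover have "(A \<inter> (\<Inter>y\<in>D. B y)) \<inter> B d = A \<inter> (\<Inter>y\<in>insert d D. B y)" by auto
  ultimately show ?case by simp
qed simp

text \<open>A sector need not be compact, but adding \<open>v\<close> makes it so; the maximum is
  not at \<open>v\<close>, where \<open>\<phi>\<close> vanishes.\<close>

lemma height_attained:
  assumes A: "sector X v A" "A \<noteq> {}"
  obtains z where "z \<in> A" "\<phi> z = height \<phi> A" "\<And>x. x \<in> A \<Longrightarrow> \<phi> x \<le> height \<phi> A"
proof -
  have sub: "insert v A \<subseteq> X" and cl: "closed (insert v A)" using A top_in unfolding sector_def by auto
  then have "compact (insert v A)" using compact_Int_closed[OF compact cl] by (simp add: Int_absorb1)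
  then obtain z where z: "z \<in> insert v A" "\<And>x. x \<in> insert v A \<Longrightarrow> \<phi> x \<le> \<phi> z"
    using continuous_attains_sup[of "insert v A" \<phi>] continuous_on_subset[OF cont sub] by auto
  obtain x where "x \<in> A" using A by blast
  then have "0 < \<phi> x" "\<phi> x \<le> \<phi> z" using positive A z unfolding sector_def by auto
  then have "z \<in> A" using z zero_iff top_in by (metis insertE less_le_not_le)
  moreover have "height \<phi> A = \<phi> z"
    unfolding height_def using \<open>z \<in> A\<close> z by (intro cSup_eq_maximum) auto
  ultimately show thesis using that z by simp
qed

lemma height_upper: "sector X v A \<Longrightarrow> x \<in> A \<Longrightarrow> \<phi> x \<le> height \<phi> A"
  using height_attained by blast

lemma height_pos: "sector X v A \<Longrightarrow> A \<noteq> {} \<Longrightarrow> 0 < height \<phi> A"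
  using height_attained positive unfolding sector_def by (metis subsetD)

lemma point_below_height:
  assumes A: "sector X v A" "A \<noteq> {}" and t: "0 < t" "t \<le> height \<phi> A"
  obtains x where "x \<in> A" "\<phi> x = t"
proof -
  obtain z where z: "z \<in> A" "\<phi> z = height \<phi> A" using height_attained A by metis
  then have "z \<in> X - {v}" using A unfolding sector_def by blast
  then obtain x where "\<phi> x = t" "\<forall>A. sector X v A \<longrightarrow> z \<in> A \<longrightarrow> x \<in> A"
    using below[of z t] t z by auto
  then show thesis using that A z by blast
qed

lemma sector_open:
  assumes "sector X v A" "x \<in> A"
  obtains e where "e > 0" "\<And>y. y \<in> X \<Longrightarrow> dist x y < e \<Longrightarrow> y \<in> A"
proof -
  have "open (- (X - A))" "x \<in> - (X - A)" using assms unfolding sector_def by (simp_all only: open_Compl) blast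
  then obtain e where "e > 0" "ball x e \<subseteq> - (X - A)" using open_contains_ball by blast
  then show thesis using that[of e] by (auto simp: subset_iff)
qed

text \<open>Here \<open>peaks\<close> enters. A peak \<open>p\<close> near a point of middle height
  has length in the wanted interval; every point of length at least \<open>hi\<close> is cut off
  from \<open>p\<close> by a sector, and by compactness finitely many of these suffice.\<close>

lemma subsector:
  assumes A: "sector X v A" "A \<noteq> {}" and t: "0 < lo" "lo < hi" "hi \<le> height \<phi> A"
  obtains B where "sector X v B" "B \<subseteq> A" "B \<noteq> {}" "lo < height \<phi> B" "height \<phi> B < hi"
proof -
  obtain x where x: "x \<in> A" "\<phi> x = (lo + hi) / 2"
    using point_below_height[OF A, of "(lo + hi) / 2"] t by auto
  have xX: "x \<in> X - {v}" using x A unfolding sector_def by blast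
  obtain e1 where e1: "e1 > 0" "\<And>y. y \<in> X \<Longrightarrow> dist x y < e1 \<Longrightarrow> y \<in> A"
    using sector_open[OF A(1) x(1)] by blast
  have "0 < (hi - lo) / 2" using t by simp
  then obtain e2 where e2: "e2 > 0" "\<And>y. y \<in> X \<Longrightarrow> dist y x < e2 \<Longrightarrow> dist (\<phi> y) (\<phi> x) < (hi - lo) / 2"
    using cont xX unfolding continuous_on_iff by blast
  obtain p where p: "p \<in> X - {v}" "dist x p < min e1 e2"
    "\<forall>y\<in>X - {v}. \<phi> p < \<phi> y \<longrightarrow> (\<exists>A. sector X v A \<and> p \<in> A \<and> y \<notin> A)"
    using peaks[OF xX, of "min e1 e2"] e1(1) e2(1) by auto
  have pA: "p \<in> A" using e1 p by auto
  have "dist (\<phi> p) (\<phi> x) < (hi - lo) / 2" using e2(2)[of p] p by (auto simp: dist_commute)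
  then have "\<bar>\<phi> p - (lo + hi) / 2\<bar> < (hi - lo) / 2" using x(2) by (simp add: dist_real_def)
  then have pt: "lo < \<phi> p" "\<phi> p < hi" by (simp_all add: abs_less_iff field_simps)
  define C where "C = X \<inter> \<phi> -` {hi..}"
  have "closed C" unfolding C_def using cont closed_X by (simp add: continuous_closed_preimage)
  then have "compact C" using compact_Int_closed[OF compact, of C] unfolding C_def by simp
  have "\<exists>A. sector X v A \<and> p \<in> A \<and> y \<notin> A" if "y \<in> C" for y
  proof -
    have "y \<in> X" "hi \<le> \<phi> y" using that unfolding C_def by auto
    moreover then have "y \<noteq> v" using t zero_iff[of v] top_in by auto
    ultimately show ?thesis using p pt by auto
  qed
  then obtain F where F: "\<And>y. y \<in> C \<Longrightarrow> sector X v (F y) \<and> p \<in> F y \<and> y \<notin> F y" by metis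
  have "v \<notin> C" unfolding C_def using t zero_iff[of v] top_in by auto
  then have cover: "C \<subseteq> (\<Union>y\<in>C. - insert v (F y))" using F by auto
  have op: "open (- insert v (F y))" if "y \<in> C" for y
    using F[OF that] unfolding sector_def by (simp only: open_Compl)
  obtain D where D: "D \<subseteq> C" "finite D" "C \<subseteq> (\<Union>y\<in>D. - insert v (F y))"
    by (rule compactE_image[OF \<open>compact C\<close> op cover])
  define B where "B = A \<inter> (\<Inter>y\<in>D. F y)"
  have B: "sector X v B" unfolding B_def using sector_Inter[OF D(2) A(1)] F D(1) by blast
  have pB: "p \<in> B" unfolding B_def using pA F D(1) by blast
  then have "B \<noteq> {}" "\<phi> p \<le> height \<phi> B" using height_upper[OF B] by blast+
  then obtain z where z: "z \<in> B" "\<phi> z = height \<phi> B" "\<phi> p \<le> height \<phi> B"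
    using height_attained[OF B] by metis
  have "z \<notin> C" using D(3) z(1) unfolding B_def by blast
  moreover have "z \<in> X" using z B unfolding sector_def by blast
  ultimately have "height \<phi> B < hi" using z unfolding C_def by auto
  then show thesis using that[of B] B pB z pt unfolding B_def by auto
qed

text \<open>Pairs of equal length that keep a fixed distance from each other and have length bounded
  away from 0 form a compact set, handled by finitely many sectors. Countably many such sets exhaust
  all pairs.\<close>

lemma separating_sequence:
  "\<exists>P :: nat \<Rightarrow> 'a set. (\<forall>n. sector X v (P n)) \<and>
    (\<forall>x y. x \<in> X - {v} \<longrightarrow> y \<in> X - {v} \<longrightarrow> x \<noteq> y \<longrightarrow> \<phi> x = \<phi> y \<longrightarrow> (\<exists>n. (x \<in> P n) \<noteq> (y \<in> P n)))"
proof -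
  define T where "T n = (X \<times> X) \<inter> (\<lambda>p. (\<phi> (fst p) - \<phi> (snd p), \<phi> (fst p), dist (fst p) (snd p))) -` ({0} \<times> {1 / Suc n..} \<times> {1 / Suc n..})" for n
  have T_iff: "(x, y) \<in> T n \<longleftrightarrow> x \<in> X \<and> y \<in> X \<and> \<phi> x = \<phi> y \<and> 1 / Suc n \<le> \<phi> x \<and> 1 / Suc n \<le> dist x y" for x y n
    unfolding T_def by auto
  have "\<exists>F. finite F \<and> (\<forall>A\<in>F. sector X v A) \<and> (\<forall>x y. (x, y) \<in> T n \<longrightarrow> (\<exists>A\<in>F. x \<in> A \<and> y \<notin> A))" for n
  proof -
    have c1: "continuous_on (X \<times> X) (\<lambda>p. \<phi> (fst p))" "continuous_on (X \<times> X) (\<lambda>p. \<phi> (snd p))"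
      by (auto intro!: continuous_on_compose2[OF cont] continuous_intros)
    have "closed (T n)"
      unfolding T_def
      by (intro continuous_closed_preimage closed_Times closed_X continuous_on_Pair continuous_on_diff c1
          continuous_on_dist continuous_on_fst continuous_on_snd continuous_on_id) auto
    moreover have "T n \<subseteq> X \<times> X" unfolding T_def by blast
    ultimately have "compact (T n)"
      using compact_Int_closed[OF compact_Times[OF compact compact], of "T n"] by (simp add: Int_absorb1)
    have X: "x \<in> X - {v}" "y \<in> X - {v}" "x \<noteq> y" "\<phi> x = \<phi> y" if "(x, y) \<in> T n" for x y
    proof -
      have "0 < 1 / real (Suc n)" by simp
      then have "0 < \<phi> x" "0 < \<phi> y" "0 < dist x y" using that unfolding T_iff by linarith+
      then show "x \<in> X - {v}" "y \<in> X - {v}" "x \<noteq> y" "\<phi> x = \<phi> y" 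
        using that zero_iff[of v] top_in unfolding T_iff by auto
    qed
    have "\<forall>p\<in>T n. \<exists>A. sector X v A \<and> fst p \<in> A \<and> snd p \<notin> A"
      using separates X by (metis prod.collapse)
    then obtain F where F: "\<And>p. p \<in> T n \<Longrightarrow> sector X v (F p) \<and> fst p \<in> F p \<and> snd p \<notin> F p" by metis
    define W where "W p = (- (X - F p)) \<times> (- insert v (F p))" for p
    have op: "open (W p)" if "p \<in> T n" for p
      using F[OF that] unfolding sector_def W_def by (intro open_Times open_Compl) auto
    have cover: "T n \<subseteq> (\<Union>p\<in>T n. W p)"
    proof
      fix p assume p: "p \<in> T n"
      then have "snd p \<noteq> v" using X(2)[of "fst p" "snd p"] by simp
      then have "p \<in> W p" using F[OF p] unfolding W_def by (auto simp: mem_Times_iff)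
      then show "p \<in> (\<Union>p\<in>T n. W p)" using p by blast
    qed
    obtain D where D: "D \<subseteq> T n" "finite D" "T n \<subseteq> (\<Union>p\<in>D. W p)"
      by (rule compactE_image[OF \<open>compact (T n)\<close> op cover])
    have "\<exists>A\<in>F ` D. x \<in> A \<and> y \<notin> A" if "(x, y) \<in> T n" for x y
    proof -
      obtain p where "p \<in> D" "(x, y) \<in> W p" using D(3) \<open>(x, y) \<in> T n\<close> by blast
      then show ?thesis using X(1)[OF that] unfolding W_def by blast
    qed
    then show ?thesis using F D by (intro exI[of _ "F ` D"]) auto
  qed
  then obtain F where F: "\<And>n. finite (F n)" "\<And>n A. A \<in> F n \<Longrightarrow> sector X v A"
    "\<And>n x y. (x, y) \<in> T n \<Longrightarrow> \<exists>A\<in>F n. x \<in> A \<and> y \<notin> A" by metis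
  \<comment> \<open>The empty sector only ensures that the enumerated family is nonempty.\<close>
  define Z where "Z = insert {} (\<Union>n. F n)"
  have Z: "countable Z" "Z \<noteq> {}" unfolding Z_def using F(1) by (auto simp: countable_finite)
  have sec: "sector X v A" if "A \<in> Z" for A using that F(2) sector_empty unfolding Z_def by blast
  show ?thesis
  proof (intro exI[of _ "from_nat_into Z"] conjI allI impI)
    show "sector X v (from_nat_into Z n)" for n using from_nat_into[OF Z(2)] sec by blast
    fix x y assume xy: "x \<in> X - {v}" "y \<in> X - {v}" "x \<noteq> y" "\<phi> x = \<phi> y"
    then have "0 < min (\<phi> x) (dist x y)" using positive by simp
    then obtain n where n: "inverse (real (Suc n)) < min (\<phi> x) (dist x y)" using reals_Archimedean by blast
    then have "(x, y) \<in> T n" unfolding T_iff using xy by (auto simp: inverse_eq_divide)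
    then obtain A where "A \<in> F n" "x \<in> A" "y \<notin> A" using F(3) by metis
    then have "A \<in> Z" "(x \<in> A) \<noteq> (y \<in> A)" unfolding Z_def by auto
    then show "\<exists>n. (x \<in> from_nat_into Z n) \<noteq> (y \<in> from_nat_into Z n)"
      using from_nat_into_surj[OF Z(1)] by metis
  qed
qed

end

section \<open>Matched sectors and how they split\<close>

text \<open>The ratio is kept as a logarithm, so that errors of successive splittings add and
  exchanging the sides changes a sign. Empty sectors match with any exponent, their height being a
  supremum without meaning.\<close>

definition matched ::
  "'a::metric_space set \<Rightarrow> 'a \<Rightarrow> ('a \<Rightarrow> real) \<Rightarrow> 'b::metric_space set \<Rightarrow> 'b \<Rightarrow> ('b \<Rightarrow> real) \<Rightarrow> 'a set \<Rightarrow> 'b set \<Rightarrow> real \<Rightarrow> bool" where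
  "matched X v \<phi> Y w \<psi> A B a \<longleftrightarrow> sector X v A \<and> sector Y w B \<and> (A = {} \<longleftrightarrow> B = {}) \<and>
     (A \<noteq> {} \<longrightarrow> height \<psi> B = exp a * height \<phi> A)"

lemma matched_sym: "matched X v \<phi> Y w \<psi> A B a \<longleftrightarrow> matched Y w \<psi> X v \<phi> B A (- a)"
  unfolding matched_def by (auto simp: exp_minus field_simps)

text \<open>The maximum of \<open>B\<close> stays with the part matched to the higher half of \<open>A\<close>; the part
  split off is taken slightly too low, which keeps it away from that maximum.\<close>

lemma matched_split_aux:
  assumes "sectored_space X v \<phi>" "sectored_space Y w \<psi>" and m: "matched X v \<phi> Y w \<psi> A B a"
    and A: "sector X v A1" "sector X v A2" "A1 \<noteq> {}" "A2 \<noteq> {}" "A1 \<union> A2 = A" "height \<phi> A1 = height \<phi> A" and e: "e > 0"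
  obtains B1 B2 a2 where "matched X v \<phi> Y w \<psi> A1 B1 a" "matched X v \<phi> Y w \<psi> A2 B2 a2"
    "B1 \<union> B2 = B" "B1 \<inter> B2 = {}" "\<bar>a2 - a\<bar> \<le> e"
proof -
  interpret X: sectored_space X v \<phi> by fact
  interpret Y: sectored_space Y w \<psi> by fact
  have AB: "sector X v A" "sector Y w B" "A \<noteq> {}" "B \<noteq> {}" "height \<psi> B = exp a * height \<phi> A"
    using m A unfolding matched_def by auto
  define hi where "hi = exp a * height \<phi> A2"
  have h2: "0 < height \<phi> A2" using X.height_pos A by blast
  then have hi0: "0 < hi" unfolding hi_def by simp
  obtain z where "z \<in> A2" "\<phi> z = height \<phi> A2" using X.height_attained A by metis
  then have "height \<phi> A2 \<le> height \<phi> A" using X.height_upper[OF AB(1), of z] A by auto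
  then have hiB: "hi \<le> height \<psi> B" unfolding hi_def AB(5) by simp
  \<comment> \<open>\<open>hi\<close> would keep the ratio unchanged; losing at most the factor
    \<open>exp (- e)\<close> moves its logarithm by at most \<open>e\<close>.\<close>
  have lo: "0 < exp (- e) * hi" "exp (- e) * hi < hi" using hi0 e by auto
  obtain B2 where B2: "sector Y w B2" "B2 \<subseteq> B" "B2 \<noteq> {}" "exp (- e) * hi < height \<psi> B2" "height \<psi> B2 < hi"
    using Y.subsector[OF AB(2,4) lo hiB] by blast
  define a2 where "a2 = ln (height \<psi> B2 / height \<phi> A2)"
  have q: "exp (a - e) < height \<psi> B2 / height \<phi> A2" "height \<psi> B2 / height \<phi> A2 < exp a"
    using B2(4,5) h2 unfolding hi_def by (simp_all add: field_simps exp_diff exp_minus)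
  then have pos: "0 < height \<psi> B2 / height \<phi> A2" by (meson exp_gt_zero less_trans)
  then have ea2: "exp a2 = height \<psi> B2 / height \<phi> A2" unfolding a2_def by simp
  then have "a - e < a2" "a2 < a" using q by (metis exp_less_cancel_iff)+
  then have 1: "\<bar>a2 - a\<bar> \<le> e" by simp
  have "height \<psi> B2 = exp a2 * height \<phi> A2" using ea2 h2 by simp
  then have 2: "matched X v \<phi> Y w \<psi> A2 B2 a2" unfolding matched_def using A B2 by blast
  define B1 where "B1 = B - B2"
  have B1: "sector Y w B1" unfolding B1_def using sector_Diff AB(2) B2(1) Y.top_in by blast
  obtain y where y: "y \<in> B" "\<psi> y = height \<psi> B" using Y.height_attained[OF AB(2,4)] by metis
  have "y \<notin> B2" using Y.height_upper[OF B2(1), of y] B2(5) y(2) hiB by auto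
  then have yB: "y \<in> B1" using y unfolding B1_def by blast
  obtain y' where y': "y' \<in> B1" "\<psi> y' = height \<psi> B1" using Y.height_attained[OF B1] yB by blast
  have "height \<psi> B1 = height \<psi> B"
    using Y.height_upper[OF B1 yB] Y.height_upper[OF AB(2), of y'] y y' unfolding B1_def by auto
  then have 3: "matched X v \<phi> Y w \<psi> A1 B1 a"
    unfolding matched_def using A B1 yB AB(5) by auto
  show thesis using that[OF 3 2 _ _ 1] B2(2) unfolding B1_def by blast
qed

text \<open>If \<open>P\<close> does not cut \<open>A\<close>, the old partner is kept. Otherwise
  the part containing a highest point of \<open>A\<close> takes the role of \<open>A1\<close> in
  \<open>matched_split_aux\<close>.\<close>

lemma matched_split:
  assumes sp: "sectored_space X v \<phi>" "sectored_space Y w \<psi>" and m: "matched X v \<phi> Y w \<psi> A B a"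
    and P: "sector X v P" and e: "e > 0"
  shows "\<exists>B1 B2 a1 a2. matched X v \<phi> Y w \<psi> (A \<inter> P) B1 a1 \<and> matched X v \<phi> Y w \<psi> (A - P) B2 a2 \<and>
    B1 \<union> B2 = B \<and> B1 \<inter> B2 = {} \<and> \<bar>a1 - a\<bar> \<le> e \<and> \<bar>a2 - a\<bar> \<le> e"
proof -
  interpret X: sectored_space X v \<phi> by fact
  interpret Y: sectored_space Y w \<psi> by fact
  have A: "sector X v A" using m unfolding matched_def by blast
  have em: "matched X v \<phi> Y w \<psi> {} {} a"
    unfolding matched_def using X.sector_empty Y.sector_empty by blast
  have sec: "sector X v (A \<inter> P)" "sector X v (A - P)"
    using sector_Int sector_Diff A P X.top_in by blast+
  consider "A \<inter> P = {}" | "A - P = {}" | "A \<inter> P \<noteq> {}" "A - P \<noteq> {}" by blast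
  then show ?thesis
  proof cases
    case 1
    then have "A - P = A" by blast
    then show ?thesis using 1 m em e by (intro exI[of _ "{}"] exI[of _ B] exI[of _ a]) simp
  next
    case 2
    then have "A \<inter> P = A" by blast
    then show ?thesis unfolding 2
      using m em e by (intro exI[of _ B] exI[of _ "{}"] exI[of _ a]) simp
  next
    case 3
    then have "A \<noteq> {}" by blast
    then obtain z where z: "z \<in> A" "\<phi> z = height \<phi> A" "\<And>x. x \<in> A \<Longrightarrow> \<phi> x \<le> height \<phi> A"
      using X.height_attained[OF A] by metis
    have full: "height \<phi> C = height \<phi> A" if C: "sector X v C" "z \<in> C" "C \<subseteq> A" for C
    proof -
      have "C \<noteq> {}" using C by blast
      then obtain z' where "z' \<in> C" "\<phi> z' = height \<phi> C" using X.height_attained[OF C(1)] by metis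
      then show ?thesis using z C X.height_upper[OF C(1,2)] by (metis antisym subsetD)
    qed
    show ?thesis
    proof (cases "z \<in> P")
      case True
      then have "height \<phi> (A \<inter> P) = height \<phi> A" using full[OF sec(1)] z by blast
      then obtain B1 B2 a2 where "matched X v \<phi> Y w \<psi> (A \<inter> P) B1 a" "matched X v \<phi> Y w \<psi> (A - P) B2 a2"
        "B1 \<union> B2 = B" "B1 \<inter> B2 = {}" "\<bar>a2 - a\<bar> \<le> e"
        using matched_split_aux[OF sp m sec 3 _ _ e] by blast
      then show ?thesis using e by (intro exI[of _ B1] exI[of _ B2] exI[of _ a] exI[of _ a2]) simp
    next
      case False
      then have "height \<phi> (A - P) = height \<phi> A" using full[OF sec(2)] z by blast
      then obtain B1 B2 a2 where "matched X v \<phi> Y w \<psi> (A - P) B1 a" "matched X v \<phi> Y w \<psi> (A \<inter> P) B2 a2"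
        "B1 \<union> B2 = B" "B1 \<inter> B2 = {}" "\<bar>a2 - a\<bar> \<le> e"
        using matched_split_aux[OF sp m sec(2,1) 3(2,1) _ _ e] by blast
      then show ?thesis using e by (intro exI[of _ B2] exI[of _ B1] exI[of _ a2] exI[of _ a]) auto
    qed
  qed
qed

text \<open>\<open>ch n t\<close> is the pair of children of node \<open>t\<close> at level \<open>n\<close>, and \<open>code\<close> follows the branch
  of the sets \<open>D t\<close> containing \<open>x\<close>.\<close>

primrec code :: "(nat \<Rightarrow> 'i \<Rightarrow> 'i \<times> 'i) \<Rightarrow> ('i \<Rightarrow> 'z set) \<Rightarrow> 'i \<Rightarrow> nat \<Rightarrow> 'z \<Rightarrow> 'i" where
  "code ch D t0 0 x = t0"
| "code ch D t0 (Suc n) x =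
    (if x \<in> D (fst (ch n (code ch D t0 n x))) then fst (ch n (code ch D t0 n x)) else snd (ch n (code ch D t0 n x)))"

text \<open>\<open>D\<close> is a parameter so that one tree can be read on both spaces;
  \<open>G\<close> is the invariant under which the children of a node are known to partition
  it.\<close>

definition splits :: "('i \<Rightarrow> bool) \<Rightarrow> (nat \<Rightarrow> 'i \<Rightarrow> 'i \<times> 'i) \<Rightarrow> ('i \<Rightarrow> 'z set) \<Rightarrow> bool" where
  "splits G ch D \<longleftrightarrow> (\<forall>n t. G t \<longrightarrow> G (fst (ch n t)) \<and> G (snd (ch n t)) \<and>
     D (fst (ch n t)) \<union> D (snd (ch n t)) = D t \<and> D (fst (ch n t)) \<inter> D (snd (ch n t)) = {})"

lemma code_mem:
  assumes "splits G ch D" "G t0" "x \<in> D t0"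
  shows "G (code ch D t0 n x) \<and> x \<in> D (code ch D t0 n x)"
proof (induction n)
  case (Suc n)
  let ?t = "code ch D t0 n x"
  have "G (fst (ch n ?t))" "G (snd (ch n ?t))" "D (fst (ch n ?t)) \<union> D (snd (ch n ?t)) = D ?t"
    using assms(1) Suc unfolding splits_def by blast+
  then show ?case using Suc by auto
qed (use assms in simp)

text \<open>Children are disjoint on the side of \<open>E\<close>, so a point of the node reached by
  \<open>x\<close> must have made the same choices. With \<open>E = D\<close> this identifies the
  points sharing the code of \<open>x\<close>; with the two sides different it finds their
  partners.\<close>

lemma code_cross:
  assumes D: "splits G ch D" and E: "splits G ch E" and t0: "G t0" "x \<in> D t0" and y: "y \<in> E (code ch D t0 n x)"
  shows "code ch E t0 n y = code ch D t0 n x"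
  using y
proof (induction n)
  case (Suc n)
  let ?t = "code ch D t0 n x"
  have G: "G ?t" using code_mem[OF D t0] by (rule conjunct1)
  then have E': "E (fst (ch n ?t)) \<union> E (snd (ch n ?t)) = E ?t" "E (fst (ch n ?t)) \<inter> E (snd (ch n ?t)) = {}"
    using E unfolding splits_def by blast+
  have "y \<in> E (fst (ch n ?t)) \<or> y \<in> E (snd (ch n ?t))" using Suc.prems by (simp split: if_splits)
  then have "y \<in> E ?t" using E'(1) by blast
  then have IH: "code ch E t0 n y = ?t" using Suc.IH by blast
  show ?case
  proof (cases "x \<in> D (fst (ch n ?t))")
    case True
    then show ?thesis using Suc.prems IH by simp
  next
    case False
    then have "y \<in> E (snd (ch n ?t))" using Suc.prems by simp
    then have "y \<notin> E (fst (ch n ?t))" using E'(2) by blast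
    then show ?thesis using False IH by simp
  qed
qed simp

text \<open>In a compact target each subsequence of images has a cluster point, and the graph
  condition allows only \<open>F a\<close>.\<close>

lemma closed_graph_continuous_on:
  fixes F :: "'a::metric_space \<Rightarrow> 'b::metric_space"
  assumes Y: "compact Y" "F ` X \<subseteq> Y"
    and graph: "\<And>xs x y. (\<And>n::nat. xs n \<in> X) \<Longrightarrow> x \<in> X \<Longrightarrow> xs \<longlonglongrightarrow> x \<Longrightarrow> (\<lambda>n. F (xs n)) \<longlonglongrightarrow> y \<Longrightarrow> y = F x"
  shows "continuous_on X F"
proof (rule continuous_on_sequentiallyI)
  fix u a assume u: "\<forall>n. u n \<in> X" "a \<in> X" "u \<longlonglongrightarrow> a"
  show "(\<lambda>n. F (u n)) \<longlonglongrightarrow> F a"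
  proof (rule ccontr)
    assume "\<not> ?thesis"
    then obtain e where e: "e > 0" "\<exists>\<^sub>F n in sequentially. e \<le> dist (F (u n)) (F a)"
      unfolding tendsto_iff not_all not_imp frequently_def by (auto simp: not_le)
    then have "infinite {n. e \<le> dist (F (u n)) (F a)}"
      by (simp add: frequently_cofinite cofinite_eq_sequentially[symmetric])
    then obtain r :: "nat \<Rightarrow> nat" where r: "strict_mono r" "\<And>n. e \<le> dist (F (u (r n))) (F a)"
      using infinite_enumerate by blast
    have "\<forall>n. F (u (r n)) \<in> Y" using u Y by blast
    then obtain y s where y: "strict_mono s" "((\<lambda>n. F (u (r n))) \<circ> s) \<longlonglongrightarrow> y"
      using Y(1) unfolding compact_def by meson
    have "y = F a"
    proof (rule graph)
      show "(\<lambda>n. u (r (s n))) \<longlonglongrightarrow> a"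
        using LIMSEQ_subseq_LIMSEQ[OF LIMSEQ_subseq_LIMSEQ[OF u(3) r(1)] y(1)] by (simp add: comp_def)
      show "(\<lambda>n. F (u (r (s n)))) \<longlonglongrightarrow> y" using y(2) by (simp add: comp_def)
    qed (use u in auto)
    then have "\<forall>\<^sub>F n in sequentially. dist (F (u (r (s n)))) (F a) < e"
      using y(2) e(1) tendstoD by (fastforce simp: comp_def)
    then obtain n where "dist (F (u (r (s n)))) (F a) < e" using eventually_happens by force
    then show False using r(2)[of "s n"] by linarith
  qed
qed

section \<open>Uniqueness of the Lelek fan\<close>

lemma geometric_steps_limit:
  fixes s :: "nat \<Rightarrow> real"
  assumes "\<And>n. \<bar>s (Suc n) - s n\<bar> \<le> (1/2)^n"
  shows "s \<longlonglongrightarrow> lim s" "\<bar>lim s - s n\<bar> \<le> 2 * (1/2)^n"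
proof -
  have le: "\<bar>s m - s n\<bar> \<le> 2 * (1/2)^n" if "n \<le> m" for m n
  proof -
    \<comment> \<open>\<open>2 * (1/2)^n\<close> is the geometric sum from \<open>n\<close> on;
      subtracting the tail from \<open>m\<close> makes the bound inductive.\<close>
    have "\<bar>s m - s n\<bar> \<le> 2 * (1/2)^n - 2 * (1/2)^m"
      using that
    proof (induction m rule: dec_induct)
      case (step m)
      then show ?case using assms[of m] by simp
    qed simp
    moreover have "0 \<le> 2 * (1/2::real)^m" by simp
    ultimately show ?thesis by linarith
  qed
  have "Cauchy s"
  proof (rule CauchyI)
    fix e :: real assume "0 < e"
    then obtain N where N: "(1/2)^N < e / 4" using real_arch_pow_inv[of "e/4" "1/2"] by auto
    have "norm (s m - s n) < e" if "N \<le> m" "N \<le> n" for m n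
      using le[OF that(1)] le[OF that(2)] N by (simp add: abs_if split: if_splits)
    then show "\<exists>M. \<forall>m\<ge>M. \<forall>n\<ge>M. norm (s m - s n) < e" by blast
  qed
  then show lim: "s \<longlonglongrightarrow> lim s" using Cauchy_convergent convergent_LIMSEQ_iff by blast
  then have "(\<lambda>m. \<bar>s m - s n\<bar>) \<longlonglongrightarrow> \<bar>lim s - s n\<bar>" by (intro tendsto_intros)
  then show "\<bar>lim s - s n\<bar> \<le> 2 * (1/2)^n"
    using le by (intro LIMSEQ_le_const2) auto
qed

section \<open>The homeomorphism given by matched codes\<close>

text \<open>The assumptions are symmetric under exchanging the spaces and negating \<open>a\<close>,
  so each result about \<open>X\<close> also serves for \<open>Y\<close>. The exponent depends on
  the code alone and is thus shared by corresponding points.\<close>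

locale matched_codes = X: sectored_space X v \<phi> + Y: sectored_space Y w \<psi>
  for X :: "'a::metric_space set" and v \<phi> and Y :: "'b::metric_space set" and w \<psi> +
  fixes \<alpha> :: "nat \<Rightarrow> 'a \<Rightarrow> 'i" and \<beta> :: "nat \<Rightarrow> 'b \<Rightarrow> 'i" and a :: "'i \<Rightarrow> real"
  assumes matchX: "\<And>x n. x \<in> X - {v} \<Longrightarrow>
      matched X v \<phi> Y w \<psi> {x' \<in> X - {v}. \<alpha> n x' = \<alpha> n x} {y \<in> Y - {w}. \<beta> n y = \<alpha> n x} (a (\<alpha> n x))"
    and matchY: "\<And>y n. y \<in> Y - {w} \<Longrightarrow>
      matched X v \<phi> Y w \<psi> {x \<in> X - {v}. \<alpha> n x = \<beta> n y} {y' \<in> Y - {w}. \<beta> n y' = \<beta> n y} (a (\<beta> n y))"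
    and stepX: "\<And>x n. x \<in> X - {v} \<Longrightarrow> \<bar>a (\<alpha> (Suc n) x) - a (\<alpha> n x)\<bar> \<le> (1/2)^n"
    and stepY: "\<And>y n. y \<in> Y - {w} \<Longrightarrow> \<bar>a (\<beta> (Suc n) y) - a (\<beta> n y)\<bar> \<le> (1/2)^n"
    and root: "\<And>x y. x \<in> X - {v} \<Longrightarrow> y \<in> Y - {w} \<Longrightarrow> \<alpha> 0 x = \<beta> 0 y"
    and refine: "\<And>x y n. x \<in> X - {v} \<Longrightarrow> y \<in> Y - {w} \<Longrightarrow> \<alpha> (Suc n) x = \<beta> (Suc n) y \<Longrightarrow> \<alpha> n x = \<beta> n y"
    and sepX: "\<And>x x'. x \<in> X - {v} \<Longrightarrow> x' \<in> X - {v} \<Longrightarrow> x \<noteq> x' \<Longrightarrow> \<phi> x = \<phi> x' \<Longrightarrow> \<exists>n. \<alpha> n x \<noteq> \<alpha> n x'"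
    and sepY: "\<And>y y'. y \<in> Y - {w} \<Longrightarrow> y' \<in> Y - {w} \<Longrightarrow> y \<noteq> y' \<Longrightarrow> \<psi> y = \<psi> y' \<Longrightarrow> \<exists>n. \<beta> n y \<noteq> \<beta> n y'"
begin

lemma swapped: "matched_codes Y w \<psi> X v \<phi> \<beta> \<alpha> (\<lambda>i. - a i)"
proof (unfold_locales, goal_cases)
  case (1 x n)
  then show ?case using matchY matched_sym by fast
next
  case (2 x n)
  then show ?case using matchX matched_sym by fast
next
  case (3 x n)
  then show ?case using stepY[of x n] by (simp add: abs_minus_commute)
next
  case (4 x n)
  then show ?case using stepX[of x n] by (simp add: abs_minus_commute)
next
  case (5 x y)
  then show ?case using root by simp
next
  case (6 x y n)
  then show ?case using refine[of y x n] by simp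
qed (use sepX sepY in blast)+

definition rate :: "'a \<Rightarrow> real" where "rate x = lim (\<lambda>n. a (\<alpha> n x))"

lemma rate_lim: "x \<in> X - {v} \<Longrightarrow> (\<lambda>n. a (\<alpha> n x)) \<longlonglongrightarrow> rate x"
  and rate_approx: "x \<in> X - {v} \<Longrightarrow> \<bar>rate x - a (\<alpha> n x)\<bar> \<le> 2 * (1/2)^n"
  using geometric_steps_limit[of "\<lambda>n. a (\<alpha> n x)", OF stepX] unfolding rate_def by simp_all

text \<open>Codes replace legs: by \<open>sepX\<close> and \<open>sepY\<close>, all codes of a point
  together with its length determine it.\<close>

definition rel :: "'a \<Rightarrow> 'b \<Rightarrow> bool" where
  "rel x y \<longleftrightarrow> x \<in> X - {v} \<and> y \<in> Y - {w} \<and> (\<forall>n. \<alpha> n x = \<beta> n y) \<and> \<psi> y = exp (rate x) * \<phi> x"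

lemma refine_le:
  assumes "x \<in> X - {v}" "y \<in> Y - {w}" "\<alpha> n x = \<beta> n y" "m \<le> n"
  shows "\<alpha> m x = \<beta> m y"
  using assms(4,3)
proof (induction n rule: dec_induct)
  case (step n)
  then show ?case using refine[OF assms(1,2)] by blast
qed

text \<open>The partner of each sector around \<open>x\<close> contains a point of the rescaled
  length, because its height is scaled by the same factor. A cluster point of these has positive
  length, so it is not \<open>w\<close>, and closedness of \<open>insert w (B m)\<close> puts it
  into every \<open>B m\<close>.\<close>

lemma rel_exists:
  assumes x: "x \<in> X - {v}"
  shows "\<exists>y. rel x y"
proof -
  define B where "B n = {y \<in> Y - {w}. \<beta> n y = \<alpha> n x}" for n
  have px: "0 < \<phi> x" using X.positive x by blast
  have B: "sector Y w (B n)" for n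
    using matchX[OF x, of n] unfolding B_def matched_def by blast
  have "\<exists>y. y \<in> B n \<and> \<psi> y = exp (a (\<alpha> n x)) * \<phi> x" for n
  proof -
    let ?A = "{x' \<in> X - {v}. \<alpha> n x' = \<alpha> n x}"
    have m: "matched X v \<phi> Y w \<psi> ?A (B n) (a (\<alpha> n x))" using matchX[OF x] unfolding B_def .
    have xA: "x \<in> ?A" using x by blast
    then have "B n \<noteq> {}" "height \<psi> (B n) = exp (a (\<alpha> n x)) * height \<phi> ?A" "\<phi> x \<le> height \<phi> ?A"
      using m X.height_upper[OF _ xA] unfolding matched_def by blast+
    then have "exp (a (\<alpha> n x)) * \<phi> x \<le> height \<psi> (B n)" by simp
    then show ?thesis using Y.point_below_height[OF B \<open>B n \<noteq> {}\<close>, of "exp (a (\<alpha> n x)) * \<phi> x"] px by (metis exp_gt_zero mult_pos_pos)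
  qed
  then obtain ys where ys: "\<And>n. ys n \<in> B n" "\<And>n. \<psi> (ys n) = exp (a (\<alpha> n x)) * \<phi> x" by metis
  have yY: "ys n \<in> Y - {w}" for n using ys(1)[of n] unfolding B_def by blast
  then have "\<forall>n. ys n \<in> Y" by blast
  then obtain y r where y: "y \<in> Y" "strict_mono r" "(ys \<circ> r) \<longlonglongrightarrow> y"
    using Y.compact unfolding compact_def by meson
  have "(\<lambda>n. \<psi> ((ys \<circ> r) n)) \<longlonglongrightarrow> \<psi> y"
    by (rule continuous_on_tendsto_compose[OF Y.cont y(3,1)]) (use yY in auto)
  moreover have "(\<lambda>n. exp (a (\<alpha> n x)) * \<phi> x) \<longlonglongrightarrow> exp (rate x) * \<phi> x"
    by (intro tendsto_intros rate_lim x)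
  then have "(\<lambda>n. \<psi> ((ys \<circ> r) n)) \<longlonglongrightarrow> exp (rate x) * \<phi> x"
    using LIMSEQ_subseq_LIMSEQ[OF _ y(2)] ys(2) by (fastforce simp: comp_def)
  ultimately have psi: "\<psi> y = exp (rate x) * \<phi> x" using LIMSEQ_unique by blast
  then have "0 < \<psi> y" using px by simp
  then have yw: "y \<noteq> w" using Y.zero_iff Y.top_in by force
  have "y \<in> B m" for m
  proof -
    have "\<forall>\<^sub>F n in sequentially. m \<le> n" by (rule eventually_ge_at_top)
    then have "\<forall>\<^sub>F n in sequentially. (ys \<circ> r) n \<in> insert w (B m)"
    proof eventually_elim
      case (elim n)
      then have "m \<le> r n" using seq_suble[OF y(2), of n] by linarith
      moreover have "\<alpha> (r n) x = \<beta> (r n) (ys (r n))" using ys(1)[of "r n"] unfolding B_def by simp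
      ultimately have "\<alpha> m x = \<beta> m (ys (r n))" using refine_le x yY by blast
      then show ?case using yY unfolding B_def by simp
    qed
    moreover have "closed (insert w (B m))" using B unfolding sector_def by blast
    ultimately have "y \<in> insert w (B m)" using Lim_in_closed_set[OF _ _ sequentially_bot y(3)] by blast
    then show ?thesis using yw by blast
  qed
  then have "\<alpha> n x = \<beta> n y" for n unfolding B_def by simp
  then have "rel x y" unfolding rel_def using x y yw psi by simp
  then show ?thesis by blast
qed

lemma rel_unique: "rel x y \<Longrightarrow> rel x y' \<Longrightarrow> y = y'"
  unfolding rel_def using sepY by metis

text \<open>Equal codes give opposite limit exponents, so the swapped construction yields the
  converse relation.\<close>

lemma rel_swapped: "rel x y \<longleftrightarrow> matched_codes.rel Y w \<psi> X v \<phi> \<beta> \<alpha> (\<lambda>i. - a i) y x"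
proof -
  interpret sw: matched_codes Y w \<psi> X v \<phi> \<beta> \<alpha> "\<lambda>i. - a i" by (rule swapped)
  have "sw.rate y = - rate x" if "x \<in> X - {v}" "\<forall>n. \<alpha> n x = \<beta> n y"
  proof -
    have "(\<lambda>n. - a (\<beta> n y)) \<longlonglongrightarrow> - rate x" 
      using tendsto_minus[OF rate_lim[OF that(1)]] that(2) by simp
    then show ?thesis unfolding sw.rate_def by (rule limI)
  qed
  then show ?thesis unfolding rel_def sw.rel_def by (auto simp: exp_minus field_simps)
qed

definition F :: "'a \<Rightarrow> 'b" where "F x = (if x = v then w else (SOME y. rel x y))"

lemma rel_F: "x \<in> X - {v} \<Longrightarrow> rel x (F x)"
  unfolding F_def using rel_exists by (auto intro: someI_ex)

lemma F_top: "F v = w" unfolding F_def by simp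

lemma F_in: "x \<in> X \<Longrightarrow> F x \<in> Y"
  using rel_F[of x] F_top Y.top_in unfolding rel_def by (cases "x = v") auto

text \<open>All points share the root code, so the rates are uniformly bounded; the 2 is the error
  of \<open>rate_approx\<close> at level 0. This serves for continuity at the top.\<close>

lemma F_bounded:
  "\<exists>C. \<forall>x\<in>X. \<psi> (F x) \<le> C * \<phi> x"
proof -
  obtain y where y: "y \<in> Y - {w}" using Y.nontrivial Y.top_in by blast
  have "\<psi> (F x) \<le> exp (a (\<beta> 0 y) + 2) * \<phi> x" if "x \<in> X" for x
  proof (cases "x = v")
    case True
    then show ?thesis using F_top X.zero_iff[of v] Y.zero_iff[of w] X.top_in Y.top_in by simp
  next
    case False
    then have x: "x \<in> X - {v}" using that by blast
    have "\<bar>rate x - a (\<beta> 0 y)\<bar> \<le> 2" using rate_approx[OF x, of 0] root[OF x y] by simp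
    then have "exp (rate x) \<le> exp (a (\<beta> 0 y) + 2)" by simp
    then show ?thesis using rel_F[OF x] X.positive[OF x] unfolding rel_def by simp
  qed
  then show ?thesis by blast
qed

text \<open>At \<open>v\<close> the linear bound forces length 0. Elsewhere sectors around
  \<open>x\<close> are open, so at each level the codes along the sequence are eventually those of
  \<open>x\<close>; this makes the rates converge, and closedness of the partner sector with
  \<open>w\<close> added passes the code to \<open>y\<close>.\<close>

lemma F_graph:
  assumes xs: "\<And>n::nat. xs n \<in> X" "x \<in> X" "xs \<longlonglongrightarrow> x" and y: "(\<lambda>n. F (xs n)) \<longlonglongrightarrow> y"
  shows "y = F x"
proof -
  have yY: "y \<in> Y" using closed_sequentially[OF Y.closed_X _ y] F_in[OF xs(1)] by simp
  have lx: "(\<lambda>n. \<phi> (xs n)) \<longlonglongrightarrow> \<phi> x"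
    by (rule continuous_on_tendsto_compose[OF X.cont xs(3,2)]) (use xs in auto)
  have ly: "(\<lambda>n. \<psi> (F (xs n))) \<longlonglongrightarrow> \<psi> y"
    by (rule continuous_on_tendsto_compose[OF Y.cont y yY]) (use xs F_in in auto)
  show ?thesis
  proof (cases "x = v")
    case True
    obtain C where C: "\<forall>x\<in>X. \<psi> (F x) \<le> C * \<phi> x" using F_bounded by blast
    have "(\<lambda>n. C * \<phi> (xs n)) \<longlonglongrightarrow> C * \<phi> x" by (intro tendsto_intros lx)
    then have "\<psi> y \<le> C * \<phi> x" using LIMSEQ_le[OF ly] C xs(1) by blast
    then have "\<psi> y \<le> 0" using True X.zero_iff[of v] X.top_in by simp
    then have "y = w" using Y.nonneg[OF yY] Y.zero_iff[OF yY] by simp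
    then show ?thesis using True F_top by simp
  next
    case False
    then have x: "x \<in> X - {v}" using xs by blast
    have ev: "\<forall>\<^sub>F k in sequentially. xs k \<in> X - {v} \<and> \<alpha> n (xs k) = \<alpha> n x" for n
    proof -
      let ?A = "{x' \<in> X - {v}. \<alpha> n x' = \<alpha> n x}"
      have "sector X v ?A" "x \<in> ?A" using matchX[OF x] x unfolding matched_def by blast+
      then obtain e where e: "e > 0" "\<And>y. y \<in> X \<Longrightarrow> dist x y < e \<Longrightarrow> y \<in> ?A"
        using X.sector_open[of ?A x] by metis
      have "\<forall>\<^sub>F k in sequentially. dist (xs k) x < e" using xs(3) e(1) tendstoD by blast
      then show ?thesis
      proof eventually_elim
        case (elim k)
        then show ?case using e(2)[of "xs k"] xs(1) by (simp add: dist_commute)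
      qed
    qed
    have code: "y \<in> insert w {y \<in> Y - {w}. \<beta> n y = \<alpha> n x}" for n
    proof (rule Lim_in_closed_set[OF _ _ sequentially_bot y])
      show "closed (insert w {y \<in> Y - {w}. \<beta> n y = \<alpha> n x})"
        using matchX[OF x, of n] unfolding matched_def sector_def by blast
      show "\<forall>\<^sub>F k in sequentially. F (xs k) \<in> insert w {y \<in> Y - {w}. \<beta> n y = \<alpha> n x}"
        using ev[of n]
      proof eventually_elim
        case (elim k)
        then have "rel (xs k) (F (xs k))" using rel_F by blast
        then show ?case using elim unfolding rel_def by simp
      qed
    qed
    have "(\<lambda>k. rate (xs k)) \<longlonglongrightarrow> rate x"
    proof (rule tendstoI)
      fix e :: real assume "0 < e"
      then obtain n where n: "(1/2)^n < e / 4" using real_arch_pow_inv[of "e/4" "1/2"] by auto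
      show "\<forall>\<^sub>F k in sequentially. dist (rate (xs k)) (rate x) < e"
        using ev[of n]
      proof eventually_elim
        case (elim k)
        then have "\<bar>rate (xs k) - a (\<alpha> n x)\<bar> \<le> 2 * (1/2)^n" using rate_approx[of "xs k" n] by simp
        then show ?case using rate_approx[OF x, of n] n unfolding dist_real_def by linarith
      qed
    qed
    then have "(\<lambda>k. exp (rate (xs k)) * \<phi> (xs k)) \<longlonglongrightarrow> exp (rate x) * \<phi> x" by (intro tendsto_intros lx)
    moreover have "\<forall>\<^sub>F k in sequentially. exp (rate (xs k)) * \<phi> (xs k) = \<psi> (F (xs k))"
      using ev[of 0]
    proof eventually_elim
      case (elim k)
      then show ?case using rel_F[of "xs k"] unfolding rel_def by simp
    qed
    ultimately have "(\<lambda>k. \<psi> (F (xs k))) \<longlonglongrightarrow> exp (rate x) * \<phi> x" by (rule Lim_transform_eventually)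
    then have psi: "\<psi> y = exp (rate x) * \<phi> x" using ly LIMSEQ_unique by blast
    then have "0 < \<psi> y" using X.positive[OF x] by simp
    then have "y \<noteq> w" using Y.zero_iff[of w] Y.top_in by auto
    then have "rel x y" unfolding rel_def using x psi code yY by auto
    then show ?thesis using rel_F[OF x] rel_unique by blast
  qed
qed

text \<open>Injectivity and surjectivity are uniqueness and existence for the swapped codes.\<close>

lemma homeomorphic: "\<exists>G. homeomorphism X Y F G"
proof (rule homeomorphism_compact)
  interpret sw: matched_codes Y w \<psi> X v \<phi> \<beta> \<alpha> "\<lambda>i. - a i" by (rule swapped)
  show "compact X" by (rule X.compact)
  show "continuous_on X F"
    by (rule closed_graph_continuous_on[OF Y.compact _ F_graph]) (use F_in in auto)
  have w: "F x \<noteq> w" if "x \<in> X - {v}" for x using rel_F[OF that] unfolding rel_def by blast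
  show "inj_on F X"
  proof (rule inj_onI)
    fix x x' assume x: "x \<in> X" "x' \<in> X" "F x = F x'"
    show "x = x'"
    proof (cases "x = v \<or> x' = v")
      case True
      then show ?thesis using x w F_top by (metis DiffI singletonD)
    next
      case False
      then have "rel x (F x)" "rel x' (F x)" using rel_F[of x] rel_F[of x'] x by auto
      then show ?thesis using rel_swapped sw.rel_unique by blast
    qed
  qed
  show "F ` X = Y"
  proof
    show "F ` X \<subseteq> Y" using F_in by blast
    show "Y \<subseteq> F ` X"
    proof
      fix y assume y: "y \<in> Y"
      show "y \<in> F ` X"
      proof (cases "y = w")
        case True
        then show ?thesis using F_top X.top_in by (metis imageI)
      next
        case False
        then obtain x where x: "rel x y" using sw.rel_exists[of y] rel_swapped y by blast
        then have "x \<in> X - {v}" unfolding rel_def by blast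
        then have "F x = y" using rel_unique[OF x] rel_F by blast
        then show ?thesis using \<open>x \<in> X - {v}\<close> by blast
      qed
    qed
  qed
qed

end

section \<open>Construction of the codes by back and forth\<close>

text \<open>A node is a pair of matched sectors with its exponent. Even steps cut in
  \<open>X\<close> by the sets \<open>P\<close>, odd steps in \<open>Y\<close> by the sets
  \<open>Q\<close>: a cut prescribed on one side gives no control over which points its partner
  separates on the other.\<close>

lemma sectored_spaces_homeomorphic:
  fixes X :: "'a::metric_space set" and Y :: "'b::metric_space set"
  assumes "sectored_space X v \<phi>" "sectored_space Y w \<psi>"
  shows "X homeomorphic Y"
proof -
  interpret X: sectored_space X v \<phi> by fact
  interpret Y: sectored_space Y w \<psi> by fact
  obtain P :: "nat \<Rightarrow> 'a set" where P: "\<And>n. sector X v (P n)"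
    "\<And>x y. x \<in> X - {v} \<Longrightarrow> y \<in> X - {v} \<Longrightarrow> x \<noteq> y \<Longrightarrow> \<phi> x = \<phi> y \<Longrightarrow> \<exists>n. (x \<in> P n) \<noteq> (y \<in> P n)"
    using X.separating_sequence by metis
  obtain Q :: "nat \<Rightarrow> 'b set" where Q: "\<And>n. sector Y w (Q n)"
    "\<And>x y. x \<in> Y - {w} \<Longrightarrow> y \<in> Y - {w} \<Longrightarrow> x \<noteq> y \<Longrightarrow> \<psi> x = \<psi> y \<Longrightarrow> \<exists>n. (x \<in> Q n) \<noteq> (y \<in> Q n)"
    using Y.separating_sequence by metis
  define D where "D t = fst t" for t :: "'a set \<times> 'b set \<times> real"
  define E where "E t = fst (snd t)" for t :: "'a set \<times> 'b set \<times> real"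
  define a where "a t = snd (snd t)" for t :: "'a set \<times> 'b set \<times> real"
  define G where "G t = matched X v \<phi> Y w \<psi> (D t) (E t) (a t)" for t
  define R where "R n t p \<longleftrightarrow> G (fst p) \<and> G (snd p) \<and>
    D (fst p) \<union> D (snd p) = D t \<and> D (fst p) \<inter> D (snd p) = {} \<and>
    E (fst p) \<union> E (snd p) = E t \<and> E (fst p) \<inter> E (snd p) = {} \<and>
    \<bar>a (fst p) - a t\<bar> \<le> (1/2)^n \<and> \<bar>a (snd p) - a t\<bar> \<le> (1/2)^n \<and>
    (if even n then D (fst p) \<subseteq> P (n div 2) \<and> D (snd p) \<inter> P (n div 2) = {}
     else E (fst p) \<subseteq> Q (n div 2) \<and> E (snd p) \<inter> Q (n div 2) = {})" for n :: nat and t p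
  have ex: "\<exists>p. R n t p" if G: "G t" for n t
  proof (cases "even n")
    case True
    obtain B1 B2 a1 a2 where "matched X v \<phi> Y w \<psi> (D t \<inter> P (n div 2)) B1 a1"
      "matched X v \<phi> Y w \<psi> (D t - P (n div 2)) B2 a2"
      "B1 \<union> B2 = E t" "B1 \<inter> B2 = {}" "\<bar>a1 - a t\<bar> \<le> (1/2)^n" "\<bar>a2 - a t\<bar> \<le> (1/2)^n"
      using matched_split[OF assms _ P(1)[of "n div 2"], of "D t" "E t" "a t" "(1/2)^n"] G unfolding G_def by auto
    then have "R n t ((D t \<inter> P (n div 2), B1, a1), (D t - P (n div 2), B2, a2))"
      unfolding R_def G_def using True by (auto simp: D_def E_def a_def)
    then show ?thesis by blast
  next
    case False
    have "matched Y w \<psi> X v \<phi> (E t) (D t) (- a t)" using G matched_sym unfolding G_def by blast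
    then obtain A1 A2 a1 a2 where "matched Y w \<psi> X v \<phi> (E t \<inter> Q (n div 2)) A1 a1"
      "matched Y w \<psi> X v \<phi> (E t - Q (n div 2)) A2 a2"
      "A1 \<union> A2 = D t" "A1 \<inter> A2 = {}" "\<bar>a1 + a t\<bar> \<le> (1/2)^n" "\<bar>a2 + a t\<bar> \<le> (1/2)^n"
      using matched_split[OF assms(2,1) _ Q(1)[of "n div 2"], of "E t" "D t" "- a t" "(1/2)^n"] by auto
    then have "R n t ((A1, E t \<inter> Q (n div 2), - a1), (A2, E t - Q (n div 2), - a2))"
      unfolding R_def G_def using False matched_sym[of Y w \<psi> X v \<phi>] by (auto simp: D_def E_def a_def abs_minus_commute abs_le_iff)
    then show ?thesis by blast
  qed
  have "\<forall>n t. \<exists>p. G t \<longrightarrow> R n t p" using ex by blast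
  then obtain ch where "\<forall>n t. G t \<longrightarrow> R n t (ch n t)" unfolding choice_iff by blast
  then have ch: "\<And>n t. G t \<Longrightarrow> R n t (ch n t)" by blast
  \<comment> \<open>The exponent of the root absorbs the ratio of total heights, so the two length
    functions may be scaled differently.\<close>
  define t0 where "t0 = (X - {v}, Y - {w}, ln (height \<psi> (Y - {w}) / height \<phi> (X - {v})))"
  have ne: "X - {v} \<noteq> {}" "Y - {w} \<noteq> {}" using X.nontrivial Y.nontrivial X.top_in Y.top_in by blast+
  have hp: "0 < height \<phi> (X - {v})" "0 < height \<psi> (Y - {w})"
    using X.height_pos[OF X.sector_whole ne(1)] Y.height_pos[OF Y.sector_whole ne(2)] by auto
  have t0: "G t0" unfolding G_def t0_def matched_def D_def E_def a_def
    using X.sector_whole Y.sector_whole ne hp by auto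
  have Dt0: "D t0 = X - {v}" "E t0 = Y - {w}" unfolding t0_def D_def E_def by auto
  have spD: "splits G ch D" and spE: "splits G ch E"
    unfolding splits_def using ch unfolding R_def by blast+
  define \<alpha> where "\<alpha> = code ch D t0"
  define \<beta> where "\<beta> = code ch E t0"
  have \<alpha>: "G (\<alpha> n x)" "x \<in> D (\<alpha> n x)" if "x \<in> X - {v}" for n x
    using code_mem[OF spD t0, of x n] that Dt0 unfolding \<alpha>_def by auto
  have \<beta>: "G (\<beta> n y)" "y \<in> E (\<beta> n y)" if "y \<in> Y - {w}" for n y
    using code_mem[OF spE t0, of y n] that Dt0 unfolding \<beta>_def by auto
  have G_sub: "D t \<subseteq> X - {v}" "E t \<subseteq> Y - {w}" if "G t" for t
    using that unfolding G_def matched_def sector_def by blast+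
  have setD: "{x' \<in> X - {v}. \<alpha> n x' = \<alpha> n x} = D (\<alpha> n x)" "{y \<in> Y - {w}. \<beta> n y = \<alpha> n x} = E (\<alpha> n x)"
    if x: "x \<in> X - {v}" for n x
  proof -
    have 1: "\<alpha> n x' = \<alpha> n x" if "x' \<in> D (\<alpha> n x)" for x'
      using code_cross[OF spD spD t0, of x x' n] x Dt0 that unfolding \<alpha>_def by blast
    have 2: "\<beta> n y = \<alpha> n x" if "y \<in> E (\<alpha> n x)" for y
      using code_cross[OF spD spE t0, of x y n] x Dt0 that unfolding \<alpha>_def \<beta>_def by blast
    have "x' \<in> X - {v} \<and> \<alpha> n x' = \<alpha> n x \<longleftrightarrow> x' \<in> D (\<alpha> n x)" for x'
      using 1[of x'] subsetD[OF G_sub(1)[OF \<alpha>(1)[OF x, of n]], of x'] \<alpha>(2)[of x' n] by metis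
    then show "{x' \<in> X - {v}. \<alpha> n x' = \<alpha> n x} = D (\<alpha> n x)" by blast
    have "y \<in> Y - {w} \<and> \<beta> n y = \<alpha> n x \<longleftrightarrow> y \<in> E (\<alpha> n x)" for y
      using 2[of y] subsetD[OF G_sub(2)[OF \<alpha>(1)[OF x, of n]], of y] \<beta>(2)[of y n] by metis
    then show "{y \<in> Y - {w}. \<beta> n y = \<alpha> n x} = E (\<alpha> n x)" by blast
  qed
  have setE: "{x \<in> X - {v}. \<alpha> n x = \<beta> n y} = D (\<beta> n y)" "{y' \<in> Y - {w}. \<beta> n y' = \<beta> n y} = E (\<beta> n y)"
    if y: "y \<in> Y - {w}" for n y
  proof -
    have 1: "\<beta> n y' = \<beta> n y" if "y' \<in> E (\<beta> n y)" for y'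
      using code_cross[OF spE spE t0, of y y' n] y Dt0 that unfolding \<beta>_def by blast
    have 2: "\<alpha> n x = \<beta> n y" if "x \<in> D (\<beta> n y)" for x
      using code_cross[OF spE spD t0, of y x n] y Dt0 that unfolding \<alpha>_def \<beta>_def by blast
    have "x \<in> X - {v} \<and> \<alpha> n x = \<beta> n y \<longleftrightarrow> x \<in> D (\<beta> n y)" for x
      using 2[of x] subsetD[OF G_sub(1)[OF \<beta>(1)[OF y, of n]], of x] \<alpha>(2)[of x n] by metis
    then show "{x \<in> X - {v}. \<alpha> n x = \<beta> n y} = D (\<beta> n y)" by blast
    have "y' \<in> Y - {w} \<and> \<beta> n y' = \<beta> n y \<longleftrightarrow> y' \<in> E (\<beta> n y)" for y'
      using 1[of y'] subsetD[OF G_sub(2)[OF \<beta>(1)[OF y, of n]], of y'] \<beta>(2)[of y' n] by metis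
    then show "{y' \<in> Y - {w}. \<beta> n y' = \<beta> n y} = E (\<beta> n y)" by blast
  qed
  have R\<alpha>: "R n (\<alpha> n x) (ch n (\<alpha> n x))" "\<alpha> (Suc n) x \<in> {fst (ch n (\<alpha> n x)), snd (ch n (\<alpha> n x))}"
    if "x \<in> X - {v}" for n x
    using ch \<alpha>(1)[OF that] unfolding \<alpha>_def by auto
  have R\<beta>: "R n (\<beta> n y) (ch n (\<beta> n y))" "\<beta> (Suc n) y \<in> {fst (ch n (\<beta> n y)), snd (ch n (\<beta> n y))}"
    if "y \<in> Y - {w}" for n y
    using ch \<beta>(1)[OF that] unfolding \<beta>_def by auto
  have "matched_codes X v \<phi> Y w \<psi> \<alpha> \<beta> a"
  proof (unfold_locales, goal_cases)
    case (1 x n)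
    then show ?case using setD \<alpha>(1) unfolding G_def by simp
  next
    case (2 y n)
    then show ?case using setE \<beta>(1) unfolding G_def by simp
  next
    case (3 x n)
    then show ?case using R\<alpha>[of x n] unfolding R_def by auto
  next
    case (4 y n)
    then show ?case using R\<beta>[of y n] unfolding R_def by auto
  next
    case (5 x y)
    then show ?case unfolding \<alpha>_def \<beta>_def by simp
  next
    case (6 x y n)
    have "y \<in> E (\<alpha> (Suc n) x)" using \<beta>(2)[OF 6(2), of "Suc n"] 6(3) by simp
    moreover have "E (\<alpha> (Suc n) x) \<subseteq> E (\<alpha> n x)" using R\<alpha>[OF 6(1), of n] unfolding R_def by auto
    ultimately have "y \<in> {y \<in> Y - {w}. \<beta> n y = \<alpha> n x}" unfolding setD(2)[OF 6(1)] by (rule subsetD[rotated])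
    then show ?case by simp
  next
    case (7 x x')
    then obtain k where k: "(x \<in> P k) \<noteq> (x' \<in> P k)" using P(2) by blast
    \<comment> \<open>Step \<open>2 * k\<close> cuts by \<open>P k\<close>, and its effect shows one
      level later.\<close>
    let ?n = "2 * k"
    have "\<alpha> (Suc ?n) x \<noteq> \<alpha> (Suc ?n) x'"
    proof
      assume eq: "\<alpha> (Suc ?n) x = \<alpha> (Suc ?n) x'"
      have "D (\<alpha> (Suc ?n) x) \<subseteq> P k \<or> D (\<alpha> (Suc ?n) x) \<inter> P k = {}"
        using R\<alpha>[OF 7(1), of ?n] unfolding R_def by auto
      moreover have "x \<in> D (\<alpha> (Suc ?n) x)" "x' \<in> D (\<alpha> (Suc ?n) x)"
        using \<alpha>(2)[OF 7(1)] \<alpha>(2)[OF 7(2)] eq by metis+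
      ultimately show False using k by blast
    qed
    then show ?case by blast
  next
    case (8 y y')
    then obtain k where k: "(y \<in> Q k) \<noteq> (y' \<in> Q k)" using Q(2) by blast
    \<comment> \<open>The odd step with quotient \<open>k\<close> is the one that cuts by
      \<open>Q k\<close>.\<close>
    let ?n = "Suc (2 * k)"
    have "\<beta> (Suc ?n) y \<noteq> \<beta> (Suc ?n) y'"
    proof
      assume eq: "\<beta> (Suc ?n) y = \<beta> (Suc ?n) y'"
      have "E (\<beta> (Suc ?n) y) \<subseteq> Q k \<or> E (\<beta> (Suc ?n) y) \<inter> Q k = {}"
        using R\<beta>[OF 8(1), of ?n] unfolding R_def by auto
      moreover have "y \<in> E (\<beta> (Suc ?n) y)" "y' \<in> E (\<beta> (Suc ?n) y)"
        using \<beta>(2)[OF 8(1)] \<beta>(2)[OF 8(2)] eq by metis+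
      ultimately show False using k by blast
    qed
    then show ?case by blast
  qed
  then show ?thesis using matched_codes.homeomorphic unfolding homeomorphic_def by blast
qed

lemma lelek_fans_homeomorphic: "lelek_fan X \<Longrightarrow> lelek_fan Y \<Longrightarrow> X homeomorphic Y"
  using lelek_fan_sectored sectored_spaces_homeomorphic by metis

section \<open>Confluence of the identity and of composites with homeomorphisms\<close>

lemma confluent_id: "confluent L (\<lambda>x. x)"
proof -
  have "K = Q" if "Q \<subseteq> L" "continuum Q" "K \<in> components (L \<inter> (\<lambda>x. x) -` Q)" for Q K
  proof -
    have "L \<inter> (\<lambda>x. x) -` Q = Q" using that(1) by auto
    then show ?thesis
      using that(2,3) connected_eq_components_subset_sing[of Q] unfolding continuum_def by auto
  qed
  then show ?thesis unfolding confluent_def by (auto intro: continuous_on_id)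
qed

text \<open>The preimage of \<open>Q\<close> under the composite is the preimage under
  \<open>r\<close> of the copy of \<open>Q\<close> in \<open>Z\<close>, so the components are the
  same.\<close>

lemma confluent_homeomorphism_compose:
  assumes h: "homeomorphism Y Z e e'" and r: "confluent L r" "r ` L = Z"
  shows "confluent L (e' \<circ> r)" "(e' \<circ> r) ` L = Y"
proof -
  show Y: "(e' \<circ> r) ` L = Y" using h r(2) by (auto simp: homeomorphism_def image_comp)
  have rZ: "r x \<in> Z" if "x \<in> L" for x using that r(2) by blast
  have cont: "continuous_on L (e' \<circ> r)"
    using h r unfolding confluent_def by (metis continuous_on_compose homeomorphism_cont2)
  have "(e' \<circ> r) ` K = Q" if Q: "Q \<subseteq> Y" "continuum Q" and K: "K \<in> components (L \<inter> (e' \<circ> r) -` Q)" for Q K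
  proof -
    have ce: "continuous_on Q e" using h Q homeomorphism_cont1 continuous_on_subset by blast
    have "L \<inter> (e' \<circ> r) -` Q = L \<inter> r -` (e ` Q)"
    proof (intro set_eqI iffI)
      fix x assume "x \<in> L \<inter> (e' \<circ> r) -` Q"
      then have "x \<in> L" "r x = e (e' (r x))" "e' (r x) \<in> Q" using rZ homeomorphism_apply2[OF h] by auto
      then show "x \<in> L \<inter> r -` (e ` Q)" by auto
    next
      fix x assume "x \<in> L \<inter> r -` (e ` Q)"
      then show "x \<in> L \<inter> (e' \<circ> r) -` Q" using homeomorphism_apply1[OF h] Q by auto
    qed
    moreover have "continuum (e ` Q)"
      using Q(2) ce by (simp add: continuum_def compact_continuous_image connected_continuous_image)
    moreover have "e ` Q \<subseteq> r ` L" using h Q r(2) by (metis homeomorphism_image1 image_mono)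
    ultimately have "r ` K = e ` Q" using r(1) K unfolding confluent_def by metis
    then have "(e' \<circ> r) ` K = e' ` e ` Q" by (metis image_comp)
    also have "\<dots> = Q" using homeomorphism_apply1[OF h] Q by (force simp: image_iff)
    finally show ?thesis .
  qed
  then show "confluent L (e' \<circ> r)" unfolding confluent_def Y using cont by blast
qed

theorem mainTheorem10:
  fixes L :: "'a::metric_space set" and Y :: "'b::metric_space set"
  assumes "lelek_fan L"
    and "continuum Y" and "nondegenerate Y"
  shows "((\<exists>e r. embedding_on Y e \<and> e ` Y \<subseteq> L \<and> retraction L (e ` Y) r \<and> confluent L r)
           \<longleftrightarrow> (\<exists>f. confluent L f \<and> f ` L = Y))
       \<and> ((\<exists>f. confluent L f \<and> f ` L = Y) \<longleftrightarrow> lelek_fan Y)"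
    (is "(?embed \<longleftrightarrow> ?image) \<and> (?image \<longleftrightarrow> ?lelek)")
proof -
  have 12: ?image if ?embed
  proof -
    obtain e r e' where e: "homeomorphism Y (e ` Y) e e'" and r: "retraction L (e ` Y) r" "confluent L r"
      using \<open>?embed\<close> unfolding embedding_on_def by blast
    have "r ` L = e ` Y"
    proof
      show "r ` L \<subseteq> e ` Y" using r(1) unfolding retraction_def by blast
      show "e ` Y \<subseteq> r ` L" using r(1) unfolding retraction_def by force
    qed
    then show ?image using confluent_homeomorphism_compose[OF e r(2)] by blast
  qed
  have 23: ?lelek if ?image
    using confluent_image_lelek_fan assms that by blast
  have 31: ?embed if ?lelek
  proof -
    obtain e e' where h: "homeomorphism Y L e e'"
      using lelek_fans_homeomorphic[OF \<open>?lelek\<close> assms(1)] unfolding homeomorphic_def by blast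
    then have "e ` Y = L" by (simp add: homeomorphism_def)
    then show ?embed
      using h confluent_id by (intro exI[of _ e] exI[of _ "\<lambda>x. x"]) (auto simp: embedding_on_def retraction_def continuous_on_id)
  qed
  show ?thesis using 12 23 31 by blast
qed

end
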